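(* Let $\bm{u}_h \in [P^N(D^k)]^n$ and define $\tilde{\bm{u}} = \bm{u}(\Pi_N\bm{v}(\bm{u}_h))$. Assume that $\tilde{\bm{u}}$, $\bm{f}_m(\bm{u}_h)$ and $\bm{f}_m(\tilde{\bm{u}})$ ($m=1,\dots,d$) are differentiable. Then the volume entropy residual $$\delta_k(\bm{u}_h) = \sum_{m=1}^d \left(\int_{D^k}-\frac{\partial \Pi_N \bm{v}(\bm{u}_h)}{\partial x_m}^T\bm{f}_m(\bm{u}_h) + \int_{\partial D^k}\psi_m(\tilde{\bm{u}}) n_m\right)$$ satisfies $$\delta_k(\bm{u}_h) = \sum_{m=1}^d\int_{D^k}\left(\bar{\bm{A}}_m\frac{\partial \Pi_N\bm{v}(\bm{u}_h)}{\partial x_m} - \Pi_N\left(\bar{\bm{A}}_m\frac{\partial \Pi_N\bm{v}(\bm{u}_h)}{\partial x_m}\right)\right)^T\left(\Pi_N \bm{v}(\bm{u}_h) - \bm{v}(\bm{u}_h)\right),$$ where $\bar{\bm{A}}_m = \bar{\bm{A}}_m(\tilde{\bm{u}}, \bm{u}_h)$ is a Roe-type linearization matrix.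
   Context: Conservation law: $\frac{\partial \bm{u}}{\partial t}+\sum_{m=1}^d \frac{\partial \bm{f}_m(\bm{u})}{\partial x_m}=0$ with $\bm{u}\in\mathbb{R}^n$ and fluxes $\bm{f}_m:\mathbb{R}^n\to\mathbb{R}^n$. $S(\bm{u})$ is a scalar convex entropy with entropy variables $\bm{v}(\bm{u})=\partial S/\partial\bm{u}$; the map $\bm{u}\mapsto\bm{v}(\bm{u})$ is invertible, with inverse denoted $\bm{v}\mapsto\bm{u}(\bm{v})$. The entropy fluxes $F_m$ satisfy $\bm{v}(\bm{u})^T\frac{\partial\bm{f}_m}{\partial\bm{u}}=\frac{\partial F_m}{\partial\bm{u}}$, and $F_m(\bm{u})=\bm{v}(\bm{u})^T\bm{f}_m(\bm{u})-\psi_m(\bm{u})$, where $\psi_m$ are the scalar entropy potentials. $D^k\subset\mathbb{R}^d$ is a simplex (affine image of a reference simplex) with outward unit normal $\bm{n}=(n_1,\dots,n_d)$ on $\partial D^k$; $P^N(D^k)$ is the space of polynomials of total degree at most $N$. All integrals are exact, and $\Pi_N$ is the (componentwise) $L^2(D^k)$ projection onto $P^N(D^k)$. Roe-type linearization matrix: a matrix $\bar{\bm{A}}_m=\bar{\bm{A}}_m(\bm{u}_1,\bm{u}_2)$ such that $\bm{f}_m(\bm{u}_1)-\bm{f}_m(\bm{u}_2)=\bar{\bm{A}}_m(\bm{u}_1,\bm{u}_2)\,(\bm{u}_1-\bm{u}_2)$. When the hyperbolic system has a strictly convex entropy, at least one such matrix exists; it can be constructed as a product of matrices defined in terms of the flux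 and entropy variable Jacobians integrated over phase space, and is then a continuous function of both its arguments. In the claim it is evaluated at $\bm{u}_1=\tilde{\bm{u}}$, $\bm{u}_2=\bm{u}_h$.
   Formalization: With f(u1)−f(u2)=A(u1−u2) the identity fails (f(u)=u, S=e^u, u_h=x on [−1,1], N=1); here the matrix is a symmetric linearization in the entropy variables, f(u1)−f(u2)=A(v(u1)−v(u2)), continuous in both arguments. *)

theory Defs
  imports "HOL-Analysis.Analysis"
begin

section \<open>Entropy structure of the conservation law\<close>

text \<open>
  States are vectors in an open set \<open>U\<close> of admissible states, where \<open>U = UNIV\<close> is allowed.
  The set accommodates systems whose entropy exists only on part of the state space.
\<close>

definition entropy_variables_on ::
    "(real ^ 'n) set \<Rightarrow> (real ^ 'n \<Rightarrow> real) \<Rightarrow> (real ^ 'n \<Rightarrow> real ^ 'n) \<Rightarrow> bool" where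
  "entropy_variables_on U S v \<longleftrightarrow>
     convex_on U S \<and> (\<forall>u\<in>U. GDERIV S u :> v u) \<and> inj_on v U"

definition entropy_flux_on ::
    "(real ^ 'n) set \<Rightarrow> (real ^ 'n \<Rightarrow> real ^ 'n) \<Rightarrow> (real ^ 'n \<Rightarrow> real ^ 'n)
      \<Rightarrow> (real ^ 'n \<Rightarrow> real) \<Rightarrow> bool" where
  "entropy_flux_on U v f F \<longleftrightarrow>
     (\<forall>u\<in>U. \<exists>f'. (f has_derivative f') (at u) \<and> (F has_derivative (\<lambda>h. v u \<bullet> f' h)) (at u))"

text \<open>
  The Roe-type linearization is taken with respect to the entropy variables and is symmetric.
  The standard example is the Jacobian of \<open>f\<close> with respect to \<open>v\<close>, which is the Hessian of
  the entropy potential in the entropy variables, averaged over the segment from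
  \<open>v u2\<close> to \<open>v u1\<close>.  Multiplied by the averaged Jacobian of \<open>v\<close> with respect to \<open>u\<close>, it
  yields a Roe matrix for the conservative variables.  With differences \<open>u1 - u2\<close> in place
  of \<open>v u1 - v u2\<close> the residual identity fails: for scalar \<open>f u = u\<close>, \<open>S u = exp u\<close> on
  \<open>[-1, 1]\<close> with degree 1 and \<open>u\<^sub>h x = x\<close>, its right-hand side is 0 and its left-hand side
  is not.
\<close>

definition roe_linearization_on ::
    "(real ^ 'n) set \<Rightarrow> (real ^ 'n \<Rightarrow> real ^ 'n) \<Rightarrow> (real ^ 'n \<Rightarrow> real ^ 'n)
      \<Rightarrow> (real ^ 'n \<Rightarrow> real ^ 'n \<Rightarrow> real ^ 'n ^ 'n) \<Rightarrow> bool" where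
  "roe_linearization_on U v f A \<longleftrightarrow>
     (\<forall>u1\<in>U. \<forall>u2\<in>U. f u1 - f u2 = A u1 u2 *v (v u1 - v u2) \<and> transpose (A u1 u2) = A u1 u2)"


section \<open>Polynomials and the \<open>L\<^sup>2\<close> projection\<close>

text \<open>
  Polynomials are functions on the whole space, which is equivalent to considering them on a
  set with nonempty interior.
\<close>

definition poly_space :: "nat \<Rightarrow> (real ^ 'd \<Rightarrow> real) set" where
  "poly_space N =
     {p. \<exists>c. p = (\<lambda>x. \<Sum>\<alpha> | sum \<alpha> UNIV \<le> N. c \<alpha> * (\<Prod>i\<in>UNIV. (x $ i) ^ \<alpha> i))}"

definition vec_poly_space :: "nat \<Rightarrow> (real ^ 'd \<Rightarrow> real ^ 'n) set" where
  "vec_poly_space N = {p. \<forall>i. (\<lambda>x. p x $ i) \<in> poly_space N}"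

definition L2_proj ::
    "(real ^ 'd) set \<Rightarrow> nat \<Rightarrow> (real ^ 'd \<Rightarrow> real) \<Rightarrow> real ^ 'd \<Rightarrow> real" where
  "L2_proj D N g =
     (THE p. p \<in> poly_space N \<and>
        (\<forall>q\<in>poly_space N. (LINT x:D|lborel. p x * q x) = (LINT x:D|lborel. g x * q x)))"

definition vec_L2_proj ::
    "(real ^ 'd) set \<Rightarrow> nat \<Rightarrow> (real ^ 'd \<Rightarrow> real ^ 'n) \<Rightarrow> real ^ 'd \<Rightarrow> real ^ 'n" where
  "vec_L2_proj D N g = (\<lambda>x. \<chi> i. L2_proj D N (\<lambda>y. g y $ i) x)"

definition partial_deriv ::
    "'d \<Rightarrow> (real ^ 'd \<Rightarrow> real ^ 'n) \<Rightarrow> real ^ 'd \<Rightarrow> real ^ 'n" where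
  "partial_deriv m w x = frechet_derivative w (at x) (axis m 1)"


section \<open>Integration over the boundary of a polytope\<close>

definition outward_unit_normal :: "(real ^ 'd) set \<Rightarrow> (real ^ 'd) set \<Rightarrow> real ^ 'd" where
  "outward_unit_normal D F =
     (THE \<nu>. norm \<nu> = 1 \<and> (\<forall>x\<in>D. \<forall>y\<in>F. \<nu> \<bullet> x \<le> \<nu> \<bullet> y))"

text \<open>
  The surface integral over a flat set \<open>F\<close> with unit normal \<open>\<nu>\<close>.  The right prism of height 1
  over \<open>F\<close> is isometric to the product of \<open>F\<close> and the unit interval, and \<open>closest_point F\<close>
  maps each of its points to the foot in \<open>F\<close>.  By Fubini, the volume integral over the prism
  of a function of the foot is its integral over \<open>F\<close> with respect to surface measure
  (counting measure if the ambient dimension is 1).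
\<close>

definition facet_integral ::
    "(real ^ 'd) set \<Rightarrow> real ^ 'd \<Rightarrow> (real ^ 'd \<Rightarrow> real) \<Rightarrow> real" where
  "facet_integral F \<nu> g =
     (LINT z:{y + t *\<^sub>R \<nu> | y t. y \<in> F \<and> 0 \<le> t \<and> t \<le> 1}|lborel. g (closest_point F z))"

definition boundary_integral ::
    "(real ^ 'd) set \<Rightarrow> (real ^ 'd \<Rightarrow> real ^ 'd \<Rightarrow> real) \<Rightarrow> real" where
  "boundary_integral D g =
     (\<Sum>F | F facet_of D. let \<nu> = outward_unit_normal D F in facet_integral F \<nu> (\<lambda>x. g x \<nu>))"


section \<open>Entropy projection and volume entropy residual\<close>

definition proj_entropy_variables ::
    "(real ^ 'd) set \<Rightarrow> nat \<Rightarrow> (real ^ 'n \<Rightarrow> real ^ 'n) \<Rightarrow> (real ^ 'd \<Rightarrow> real ^ 'n)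
      \<Rightarrow> real ^ 'd \<Rightarrow> real ^ 'n" where
  "proj_entropy_variables D N v u\<^sub>h = vec_L2_proj D N (\<lambda>x. v (u\<^sub>h x))"

definition entropy_projection ::
    "(real ^ 'n) set \<Rightarrow> (real ^ 'd) set \<Rightarrow> nat \<Rightarrow> (real ^ 'n \<Rightarrow> real ^ 'n)
      \<Rightarrow> (real ^ 'd \<Rightarrow> real ^ 'n) \<Rightarrow> real ^ 'd \<Rightarrow> real ^ 'n" where
  "entropy_projection U D N v u\<^sub>h = (\<lambda>x. inv_into U v (proj_entropy_variables D N v u\<^sub>h x))"

definition volume_entropy_residual ::
    "(real ^ 'n) set \<Rightarrow> (real ^ 'd) set \<Rightarrow> nat \<Rightarrow> (real ^ 'n \<Rightarrow> real ^ 'n)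
      \<Rightarrow> ('d \<Rightarrow> real ^ 'n \<Rightarrow> real ^ 'n) \<Rightarrow> ('d \<Rightarrow> real ^ 'n \<Rightarrow> real)
      \<Rightarrow> (real ^ 'd \<Rightarrow> real ^ 'n) \<Rightarrow> real" where
  "volume_entropy_residual U D N v f \<psi> u\<^sub>h =
     (\<Sum>m\<in>UNIV.
        (LINT x:D|lborel. - (partial_deriv m (proj_entropy_variables D N v u\<^sub>h) x \<bullet> f m (u\<^sub>h x)))
        + boundary_integral D (\<lambda>x \<nu>. \<psi> m (entropy_projection U D N v u\<^sub>h x) * \<nu> $ m))"

end

theory Submission
  imports Defs "HOL-Computational_Algebra.Polynomial"
begin

text \<open>
  Write \<open>w\<close> for the projected entropy variables and \<open>u_tilde\<close> for the state with \<open>v u_tilde = w\<close>.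
  The entropy flux condition makes the derivative of \<open>\<psi>\<^sub>m(u_tilde)\<close> in direction \<open>h\<close> equal to
  \<open>w' h \<bullet> f\<^sub>m(u_tilde)\<close>, which is continuous although \<open>v\<close> need not be differentiable.  The
  divergence theorem therefore turns the residual into the sum of the integrals of
  \<open>\<partial>\<^sub>m w \<bullet> (f\<^sub>m(u_tilde) - f\<^sub>m(u\<^sub>h))\<close>.  By the Roe property and the symmetry of the matrix this is
  \<open>A\<^sub>m \<partial>\<^sub>m w \<bullet> (w - v(u\<^sub>h))\<close>, and the projection of \<open>A\<^sub>m \<partial>\<^sub>m w\<close> may be subtracted because
  \<open>w - v(u\<^sub>h)\<close> is orthogonal to polynomials.

  The divergence theorem need only be shown for the directions of the edges, which span the space.
\<close>

section \<open>Lebesgue measure along lines and under shears\<close>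

text \<open>\<open>boundary_integral\<close> is built from volume integrals over prisms, so the
  divergence theorem can be proved with Lebesgue measure alone. Integrals along lines parallel to an
  edge are collected over a slab that each such line crosses in a parameter interval of length 1.
  The two facets hit by these lines then contribute integrals over oblique prisms. The obstacle is
  to compare these with the right prisms of height 1 in \<open>facet_integral\<close>: a
  measure-preserving shear changes the direction of a prism, and a change of the slab changes its
  thickness by a constant factor. Two further points need an argument. The map \<open>v\<close> is
  given only as the gradient of a convex function, so its continuity has to come from convexity.
  Projections are given by a definite description, so existence and uniqueness must be established
  before \<open>w\<close> is known to be a polynomial.\<close>

lemma nn_integral_lborel_shift:
  fixes f :: "'a::euclidean_space \<Rightarrow> ennreal"
  assumes [measurable]: "f \<in> borel_measurable borel"
  shows "(\<integral>\<^sup>+x. f (x + c) \<partial>lborel) = (\<integral>\<^sup>+x. f x \<partial>lborel)"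
proof -
  have "(\<integral>\<^sup>+x. f x \<partial>lborel) = (\<integral>\<^sup>+x. f x \<partial>distr lborel borel ((+) c))"
    by (simp add: lborel_distr_plus)
  also have "\<dots> = (\<integral>\<^sup>+x. f (c + x) \<partial>lborel)"
    by (subst nn_integral_distr) auto
  finally show ?thesis by (simp add: add.commute)
qed

lemma nn_integral_unit_window:
  shows "(\<integral>\<^sup>+t. indicator {0..1::real} (s - t) \<partial>lborel) = 1"
    and "(\<integral>\<^sup>+t. indicator {0..1::real} (t - s) \<partial>lborel) = 1"
proof -
  have "(\<integral>\<^sup>+t. indicator {0..1::real} (s - t) \<partial>lborel) = (\<integral>\<^sup>+t. indicator {s - 1..s} t \<partial>lborel)"
    by (intro nn_integral_cong) (auto split: split_indicator)
  then show "(\<integral>\<^sup>+t. indicator {0..1::real} (s - t) \<partial>lborel) = 1" by simp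
  have "(\<integral>\<^sup>+t. indicator {0..1::real} (t - s) \<partial>lborel) = (\<integral>\<^sup>+t. indicator {s..s + 1} t \<partial>lborel)"
    by (intro nn_integral_cong) (auto split: split_indicator)
  then show "(\<integral>\<^sup>+t. indicator {0..1::real} (t - s) \<partial>lborel) = 1" by simp
qed

text \<open>A Fubini theorem along the lines parallel to \<open>e\<close>, without coordinates.\<close>


lemma distr_slab_lines:
  fixes a e :: "'a::euclidean_space"
  assumes ae: "a \<bullet> e = 1"
  shows "distr (density (lborel \<Otimes>\<^sub>M (lborel :: real measure))
           (\<lambda>(z, t). indicator {0..1} (a \<bullet> z - b))) borel (\<lambda>(z, t). z + t *\<^sub>R e) = lborel"
    (is "distr (density ?P ?w) borel ?h = lborel")
proof (rule measure_eqI)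
  show "sets (distr (density ?P ?w) borel ?h) = sets lborel" by simp
  fix X assume "X \<in> sets (distr (density ?P ?w) borel ?h)"
  then have X[measurable]: "X \<in> sets borel" by simp
  have [measurable]: "?w \<in> borel_measurable ?P" "?h \<in> ?P \<rightarrow>\<^sub>M borel"
    by measurable
  have "emeasure (distr (density ?P ?w) borel ?h) X
      = (\<integral>\<^sup>+y. indicator X y \<partial>distr (density ?P ?w) borel ?h)"
    by simp
  also have "\<dots> = (\<integral>\<^sup>+y. indicator X (?h y) \<partial>density ?P ?w)"
    by (subst nn_integral_distr) auto
  also have "\<dots> = (\<integral>\<^sup>+y. ?w y * indicator X (?h y) \<partial>?P)"
    by (subst nn_integral_density) auto
  also have "\<dots> = (\<integral>\<^sup>+t. \<integral>\<^sup>+z. indicator {0..1} (a \<bullet> z - b) * indicator X (z + t *\<^sub>R e) \<partial>lborel \<partial>lborel)"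
    by (subst lborel_pair.nn_integral_snd[symmetric]) auto
  \<comment> \<open>Translating \<open>z\<close> by \<open>t *\<^sub>R e\<close> moves the
    dependence on \<open>t\<close> from \<open>X\<close> to the window. After exchanging the
    integrals, the window has mass 1 for every \<open>z\<close>.\<close>
  also have "\<dots> = (\<integral>\<^sup>+t. \<integral>\<^sup>+z. indicator {0..1} (a \<bullet> z - b - t) * indicator X z \<partial>lborel \<partial>lborel)"
  proof (rule nn_integral_cong)
    fix t :: real
    have "(\<integral>\<^sup>+z. indicator {0..1} (a \<bullet> z - b) * indicator X (z + t *\<^sub>R e) \<partial>lborel)
       = (\<integral>\<^sup>+z. (\<lambda>z. indicator {0..1} (a \<bullet> z - b - t) * indicator X z) (z + t *\<^sub>R e) \<partial>lborel)"
      using ae by (simp add: inner_add_right)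
    also have "\<dots> = (\<integral>\<^sup>+z. indicator {0..1} (a \<bullet> z - b - t) * indicator X z \<partial>lborel)"
      by (rule nn_integral_lborel_shift) measurable
    finally show "(\<integral>\<^sup>+z. indicator {0..1} (a \<bullet> z - b) * indicator X (z + t *\<^sub>R e) \<partial>lborel)
       = (\<integral>\<^sup>+z. indicator {0..1} (a \<bullet> z - b - t) * indicator X z \<partial>lborel)" .
  qed
  also have "\<dots> = (\<integral>\<^sup>+z. \<integral>\<^sup>+t. indicator {0..1} (a \<bullet> z - b - t) * indicator X z \<partial>lborel \<partial>lborel)"
    by (rule lborel_pair.Fubini') measurable
  also have "\<dots> = (\<integral>\<^sup>+z. indicator X z \<partial>lborel)"
    by (simp add: nn_integral_multc nn_integral_unit_window)
  also have "\<dots> = emeasure lborel X" by simp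
  finally show "emeasure (distr (density ?P ?w) borel ?h) X = emeasure lborel X" .
qed

text \<open>The map translates each level set of \<open>a \<bullet> z\<close> within itself. The
  proof averages over translations by \<open>t *\<^sub>R \<tau>\<close> with \<open>t\<close> in the
  unit interval; a shear by \<open>l z\<close> then only shifts the interval for \<open>t\<close>,
  and this does not change its length.\<close>

lemma distr_shear:
  fixes a \<tau> :: "'a::euclidean_space"
  assumes a\<tau>: "a \<bullet> \<tau> = 0"
  shows "distr lborel borel (\<lambda>z. z + (a \<bullet> z - b) *\<^sub>R \<tau>) = lborel" (is "distr lborel borel ?h = lborel")
proof (rule measure_eqI)
  show "sets (distr lborel borel ?h) = sets lborel" by simp
  fix X assume "X \<in> sets (distr lborel borel ?h)"
  then have X[measurable]: "X \<in> sets borel" by simp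
  define l where "l z = a \<bullet> z - b" for z
  have [measurable]: "l \<in> borel_measurable borel" unfolding l_def by measurable
  have l: "l (z + t *\<^sub>R \<tau>) = l z" for z t using a\<tau> by (simp add: l_def inner_add_right)
  have "emeasure (distr lborel borel ?h) X = (\<integral>\<^sup>+y. indicator X y \<partial>distr lborel borel ?h)"
    by simp
  also have "\<dots> = (\<integral>\<^sup>+z. indicator X (z + l z *\<^sub>R \<tau>) \<partial>lborel)"
    by (subst nn_integral_distr) (auto simp: l_def)
  also have "\<dots> = (\<integral>\<^sup>+t. indicator {0..1::real} t * (\<integral>\<^sup>+z. indicator X (z + l z *\<^sub>R \<tau>) \<partial>lborel) \<partial>lborel)"
    by (subst nn_integral_multc) auto
  also have "\<dots> = (\<integral>\<^sup>+t. \<integral>\<^sup>+z. indicator {0..1::real} t * indicator X (z + (t + l z) *\<^sub>R \<tau>) \<partial>lborel \<partial>lborel)"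
  proof (rule nn_integral_cong)
    fix t :: real
    have "(\<integral>\<^sup>+z. indicator X (z + l z *\<^sub>R \<tau>) \<partial>lborel)
        = (\<integral>\<^sup>+z. (\<lambda>z. indicator X (z + l z *\<^sub>R \<tau>)) (z + t *\<^sub>R \<tau>) \<partial>lborel)"
      by (rule nn_integral_lborel_shift[symmetric]) measurable
    also have "\<dots> = (\<integral>\<^sup>+z. indicator X (z + (t + l z) *\<^sub>R \<tau>) \<partial>lborel)"
      by (simp add: l algebra_simps)
    finally show "indicator {0..1} t * (\<integral>\<^sup>+z. indicator X (z + l z *\<^sub>R \<tau>) \<partial>lborel) =
        (\<integral>\<^sup>+z. indicator {0..1::real} t * indicator X (z + (t + l z) *\<^sub>R \<tau>) \<partial>lborel)"
      by (subst nn_integral_cmult) auto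
  qed
  also have "\<dots> = (\<integral>\<^sup>+z. \<integral>\<^sup>+t. indicator {0..1::real} t * indicator X (z + (t + l z) *\<^sub>R \<tau>) \<partial>lborel \<partial>lborel)"
    by (rule lborel_pair.Fubini') measurable
  \<comment> \<open>Substituting for \<open>t\<close> at fixed \<open>z\<close> moves the shear out
    of the argument of \<open>X\<close>. The remaining translation by
    \<open>t *\<^sub>R \<tau>\<close> leaves \<open>l\<close> unchanged and can be undone at fixed
    \<open>t\<close>.\<close>
  also have "\<dots> = (\<integral>\<^sup>+z. \<integral>\<^sup>+t. indicator {0..1::real} (t - l z) * indicator X (z + t *\<^sub>R \<tau>) \<partial>lborel \<partial>lborel)"
  proof (rule nn_integral_cong)
    fix z
    have "(\<integral>\<^sup>+t. indicator {0..1::real} (t - l z) * indicator X (z + t *\<^sub>R \<tau>) \<partial>lborel)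
      = (\<integral>\<^sup>+t. (\<lambda>t. indicator {0..1::real} (t - l z) * indicator X (z + t *\<^sub>R \<tau>)) (t + l z) \<partial>lborel)"
      by (rule nn_integral_lborel_shift[symmetric]) measurable
    then show "(\<integral>\<^sup>+t. indicator {0..1::real} t * indicator X (z + (t + l z) *\<^sub>R \<tau>) \<partial>lborel)
      = (\<integral>\<^sup>+t. indicator {0..1::real} (t - l z) * indicator X (z + t *\<^sub>R \<tau>) \<partial>lborel)"
      by simp
  qed
  also have "\<dots> = (\<integral>\<^sup>+t. \<integral>\<^sup>+z. indicator {0..1::real} (t - l z) * indicator X (z + t *\<^sub>R \<tau>) \<partial>lborel \<partial>lborel)"
    by (rule lborel_pair.Fubini'[symmetric]) measurable
  also have "\<dots> = (\<integral>\<^sup>+t. \<integral>\<^sup>+z. indicator {0..1::real} (t - l z) * indicator X z \<partial>lborel \<partial>lborel)"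
  proof (rule nn_integral_cong)
    fix t :: real
    have "(\<integral>\<^sup>+z. indicator {0..1::real} (t - l z) * indicator X z \<partial>lborel)
      = (\<integral>\<^sup>+z. (\<lambda>z. indicator {0..1::real} (t - l z) * indicator X z) (z + t *\<^sub>R \<tau>) \<partial>lborel)"
      by (rule nn_integral_lborel_shift[symmetric]) measurable
    then show "(\<integral>\<^sup>+z. indicator {0..1::real} (t - l z) * indicator X (z + t *\<^sub>R \<tau>) \<partial>lborel)
       = (\<integral>\<^sup>+z. indicator {0..1::real} (t - l z) * indicator X z \<partial>lborel)"
      by (simp add: l)
  qed
  also have "\<dots> = (\<integral>\<^sup>+z. \<integral>\<^sup>+t. indicator {0..1::real} (t - l z) * indicator X z \<partial>lborel \<partial>lborel)"
    by (rule lborel_pair.Fubini') measurable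
  also have "\<dots> = (\<integral>\<^sup>+z. indicator X z \<partial>lborel)"
    by (simp add: nn_integral_multc nn_integral_unit_window)
  also have "\<dots> = emeasure lborel X" by simp
  finally show "emeasure (distr lborel borel ?h) X = emeasure lborel X" .
qed

text \<open>Since \<open>a \<bullet> e = 1\<close>, every line parallel to \<open>e\<close> has a
  parameter interval of length 1 inside the slab, so each line integral is counted with total weight
  1.\<close>

lemma integral_slab_lines:
  fixes a e :: "'a::euclidean_space" and k :: "'a \<Rightarrow> real"
  assumes ae: "a \<bullet> e = 1" and k: "integrable lborel k"
  shows "(LINT z|lborel. k z)
    = (LINT z|lborel. indicator {0..1} (a \<bullet> z - b) * (LINT t|lborel. k (z + t *\<^sub>R e)))"
proof -
  let ?P = "(lborel :: 'a measure) \<Otimes>\<^sub>M (lborel :: real measure)"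
  let ?w = "\<lambda>(z, t::real). indicator {0..1} (a \<bullet> z - b) :: real"
  let ?D = "density ?P (\<lambda>y. ennreal (?w y))"
  let ?h = "\<lambda>(z::'a, t::real). z + t *\<^sub>R e"
  have [measurable]: "k \<in> borel_measurable borel" using k by auto
  have [measurable]: "?w \<in> borel_measurable ?P" "?h \<in> ?P \<rightarrow>\<^sub>M borel"
    by measurable
  have "(\<lambda>y. ennreal (?w y)) = (\<lambda>(z, t). indicator {0..1} (a \<bullet> z - b))"
    by (auto simp: fun_eq_iff ennreal_indicator)
  then have eq: "distr ?D borel ?h = lborel"
    using distr_slab_lines[OF ae, of b] by (simp only:)
  have "integrable (distr ?D borel ?h) k"
    using k by (simp only: eq)
  then have "integrable ?D (\<lambda>y. k (?h y))"
    by (subst (asm) integrable_distr_eq) auto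
  then have int: "integrable ?P (\<lambda>y. ?w y *\<^sub>R k (?h y))"
    by (subst (asm) integrable_density) auto
  have "(LINT z|lborel. k z) = (LINT z|distr ?D borel ?h. k z)"
    by (simp only: eq)
  also have "\<dots> = (LINT y|?D. k (?h y))"
    by (subst integral_distr) auto
  also have "\<dots> = (LINT y|?P. ?w y *\<^sub>R k (?h y))"
    by (subst integral_density) auto
  also have "\<dots> = (LINT z|lborel. LINT t|lborel. indicator {0..1} (a \<bullet> z - b) * k (z + t *\<^sub>R e))"
    using lborel_pair.integral_fst'[OF int] by simp
  finally show ?thesis by simp
qed

section \<open>Integrals over flat sets by oblique slabs\<close>

text \<open>
  For \<open>H\<close> supported on a subset \<open>F\<close> of the hyperplane \<open>a \<bullet> y = b\<close> and \<open>a \<bullet> e = 1\<close>, this is the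
  integral over the oblique prism \<open>F + [0, 1] e\<close> of the extension of \<open>H\<close> that is constant along
  \<open>e\<close>.  It does not depend on \<open>e\<close>, and for a unit vector \<open>a = e\<close> it is the surface integral.
\<close>

definition slab_integral :: "'a::euclidean_space \<Rightarrow> real \<Rightarrow> 'a \<Rightarrow> ('a \<Rightarrow> real) \<Rightarrow> real" where
  "slab_integral a b e H =
     (LINT z|lborel. indicator {0..1} (a \<bullet> z - b) * H (z - (a \<bullet> z - b) *\<^sub>R e))"

text \<open>The shear along \<open>e' - e\<close> keeps \<open>a \<bullet> z\<close>, fixes the
  hyperplane \<open>a \<bullet> z = b\<close> pointwise and carries one oblique prism to the
  other.\<close>

lemma slab_integral_direction:
  assumes ae: "a \<bullet> e = 1" "a \<bullet> e' = 1" and [measurable]: "H \<in> borel_measurable borel"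
  shows "slab_integral a b e H = slab_integral a b e' H"
proof -
  let ?h = "\<lambda>z. z + (a \<bullet> z - b) *\<^sub>R (e' - e)"
  have eq: "distr lborel borel ?h = lborel"
    using ae by (intro distr_shear) (simp add: inner_diff_right)
  have "slab_integral a b e' H =
      (LINT z|distr lborel borel ?h. indicator {0..1} (a \<bullet> z - b) * H (z - (a \<bullet> z - b) *\<^sub>R e'))"
    unfolding eq slab_integral_def ..
  also have "\<dots> = (LINT z|lborel. indicator {0..1} (a \<bullet> ?h z - b) * H (?h z - (a \<bullet> ?h z - b) *\<^sub>R e'))"
    by (subst integral_distr) auto
  also have "\<dots> = slab_integral a b e H"
    using ae by (simp add: slab_integral_def inner_add_right inner_diff_right algebra_simps)
  finally show ?thesis by simp
qed

text \<open>The extension of \<open>H\<close> is constant along \<open>e\<close>, and a line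
  parallel to \<open>e\<close> stays in the slab of \<open>a'\<close> for a parameter interval of
  length \<open>1 / \<bar>a' \<bullet> e\<bar>\<close>. This serves both to rescale a normal and to
  measure two facets in a common slab.\<close>

lemma slab_integral_window:
  assumes ae: "a \<bullet> e = 1" and a': "a' \<bullet> e \<noteq> 0"
    and int: "integrable lborel (\<lambda>z. indicator {0..1} (a' \<bullet> z - b') * H (z - (a \<bullet> z - b) *\<^sub>R e))"
  shows "(LINT z|lborel. indicator {0..1} (a' \<bullet> z - b') * H (z - (a \<bullet> z - b) *\<^sub>R e))
    = slab_integral a b e H / \<bar>a' \<bullet> e\<bar>"
proof -
  have win: "(LINT t|lborel. indicator {0..1} (s + t * r)) = 1 / \<bar>r\<bar>" if "r \<noteq> 0" for s r :: real
  proof -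
    have "(LINT t|lborel. indicator {0..1::real} t :: real) = \<bar>r\<bar> *\<^sub>R (LINT t|lborel. indicator {0..1} (s + r * t) :: real)"
      using lborel_integral_real_affine[OF that, of "indicator {0..1} :: real \<Rightarrow> real" s] by (simp add: content_real)
    then show ?thesis using that by (simp add: field_simps)
  qed
  have "(LINT t|lborel. indicator {0..1} (a' \<bullet> (z + t *\<^sub>R e) - b')
      * H (z + t *\<^sub>R e - (a \<bullet> (z + t *\<^sub>R e) - b) *\<^sub>R e))
    = H (z - (a \<bullet> z - b) *\<^sub>R e) / \<bar>a' \<bullet> e\<bar>" (is "?L = _") for z
  proof -
    have "?L = (LINT t|lborel. indicator {0..1} ((a' \<bullet> z - b') + t * (a' \<bullet> e))
        * H (z - (a \<bullet> z - b) *\<^sub>R e))"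
      using ae by (intro Bochner_Integration.integral_cong) (auto simp: inner_add_right algebra_simps)
    also have "\<dots> = (LINT t|lborel. indicator {0..1} ((a' \<bullet> z - b') + t * (a' \<bullet> e)))
        * H (z - (a \<bullet> z - b) *\<^sub>R e)"
      by simp
    finally show ?thesis using win[OF a'] by simp
  qed
  then show ?thesis
    by (subst integral_slab_lines[OF ae int, of b]) (simp add: slab_integral_def)
qed

lemma integrable_slab:
  fixes H :: "'a::euclidean_space \<Rightarrow> real"
  assumes a': "a' \<bullet> e \<noteq> 0" and [measurable]: "H \<in> borel_measurable borel"
    and F: "bounded F" and H: "\<And>y. \<bar>H y\<bar> \<le> B" "\<And>y. y \<notin> F \<Longrightarrow> H y = 0"
  shows "integrable lborel (\<lambda>z. indicator {0..1} (a' \<bullet> z - b') * H (z - (a \<bullet> z - b) *\<^sub>R e))"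
proof -
  obtain R where R: "\<And>y. y \<in> F \<Longrightarrow> norm y \<le> R"
    using F by (auto simp: bounded_iff)
  \<comment> \<open>For \<open>z = y + t *\<^sub>R e\<close> with \<open>y\<close> in
    \<open>F\<close>, the window bounds \<open>t * (a' \<bullet> e)\<close> by the numerator. Hence
    \<open>T\<close> bounds the travel along \<open>e\<close>, and the support is bounded.\<close>
  define T where "T = (1 + \<bar>b'\<bar> + norm a' * R) / \<bar>a' \<bullet> e\<bar>"
  have "norm z \<le> R + T * norm e"
    if y: "z - (a \<bullet> z - b) *\<^sub>R e \<in> F" and w: "a' \<bullet> z - b' \<in> {0..1}" for z
  proof -
    define t where "t = a \<bullet> z - b"
    define y where "y = z - t *\<^sub>R e"
    have z: "z = y + t *\<^sub>R e" by (simp add: y_def)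
    have yR: "norm y \<le> R" using y R by (simp add: y_def t_def)
    have "\<bar>a' \<bullet> y\<bar> \<le> norm a' * R"
      using Cauchy_Schwarz_ineq2[of a' y] mult_left_mono[OF yR, of "norm a'"] by simp
    moreover have "a' \<bullet> z = a' \<bullet> y + t * (a' \<bullet> e)"
      by (simp add: z inner_add_right)
    ultimately have "\<bar>t * (a' \<bullet> e)\<bar> \<le> 1 + \<bar>b'\<bar> + norm a' * R"
      using w by auto
    then have "\<bar>t\<bar> \<le> T"
      using a' by (simp add: T_def abs_mult field_simps)
    then have "norm (t *\<^sub>R e) \<le> T * norm e"
      by (simp add: mult_right_mono)
    then show ?thesis
      using norm_triangle_ineq[of y "t *\<^sub>R e"] yR z by simp
  qed
  then have supp: "z \<in> cball 0 (R + T * norm e)"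
    if "indicator {0..1} (a' \<bullet> z - b') * H (z - (a \<bullet> z - b) *\<^sub>R e) \<noteq> 0" for z
    using that H(2) by (fastforce split: split_indicator_asm)
  show ?thesis
  proof (rule integrableI_bounded_set[where A = "cball 0 (R + T * norm e)" and B = B])
    show "emeasure lborel (cball (0::'a) (R + T * norm e)) < \<infinity>"
      by (rule emeasure_bounded_finite) auto
    have "\<bar>H 0\<bar> \<le> B" by (rule H)
    then have "0 \<le> B" by linarith
    then show "AE z in lborel. z \<in> cball 0 (R + T * norm e) \<longrightarrow>
        norm (indicator {0..1} (a' \<bullet> z - b') * H (z - (a \<bullet> z - b) *\<^sub>R e)) \<le> B"
      using H(1) by (auto simp: abs_mult split: split_indicator)
    show "AE z in lborel. z \<notin> cball 0 (R + T * norm e) \<longrightarrow>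
        indicator {0..1} (a' \<bullet> z - b') * H (z - (a \<bullet> z - b) *\<^sub>R e) = 0"
      using supp by blast
  qed measurable
qed

lemma cutoff_continuous_compact:
  fixes g :: "'a::euclidean_space \<Rightarrow> real"
  assumes "compact F" "continuous_on F g"
  shows "(\<lambda>y. indicator F y * g y) \<in> borel_measurable borel"
    and "\<exists>B. \<forall>y. \<bar>indicator F y * g y\<bar> \<le> B"
proof -
  show "(\<lambda>y. indicator F y * g y) \<in> borel_measurable borel"
    using borel_measurable_continuous_on_indicator[of F g] assms
    by (simp add: borel_compact)
  have "bounded (g ` F)"
    using assms compact_continuous_image compact_imp_bounded by blast
  then obtain B where B: "\<And>y. y \<in> F \<Longrightarrow> \<bar>g y\<bar> \<le> B"
    by (auto simp: bounded_iff)
  then have "\<bar>indicator F y * g y\<bar> \<le> max B 0" for y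
    by (auto simp: indicator_def intro: order_trans[OF B])
  then show "\<exists>B. \<forall>y. \<bar>indicator F y * g y\<bar> \<le> B" by blast
qed

lemma integrable_slab_continuous:
  fixes g :: "'a::euclidean_space \<Rightarrow> real"
  assumes "a' \<bullet> e \<noteq> 0" "compact F" "continuous_on F g"
  shows "integrable lborel (\<lambda>z. indicator {0..1} (a' \<bullet> z - b') *
    (\<lambda>y. indicator F y * g y) (z - (a \<bullet> z - b) *\<^sub>R e))"
proof -
  obtain B where B: "\<And>y. \<bar>indicator F y * g y\<bar> \<le> B"
    using cutoff_continuous_compact(2)[OF assms(2,3)] by blast
  show ?thesis
    by (rule integrable_slab[where F = F, OF assms(1) cutoff_continuous_compact(1)[OF assms(2,3)] _ B])
       (use assms in \<open>auto intro: compact_imp_bounded\<close>)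
qed

text \<open>\<open>\<nu>\<close> is orthogonal to the hyperplane containing \<open>F\<close>, so by
  Pythagoras the closest point of \<open>F\<close> to a point of the prism is its foot
  \<open>z - (\<nu> \<bullet> z - b) *\<^sub>R \<nu>\<close>.\<close>

lemma facet_integral_unit_slab:
  fixes F :: "(real ^ 'd) set"
  assumes F: "convex F" "closed F" "\<And>y. y \<in> F \<Longrightarrow> \<nu> \<bullet> y = b" and \<nu>: "norm \<nu> = 1"
  shows "facet_integral F \<nu> g = slab_integral \<nu> b \<nu> (\<lambda>y. indicator F y * g y)"
proof -
  have \<nu>1: "\<nu> \<bullet> \<nu> = 1" using \<nu> by (simp add: dot_square_norm)
  let ?Q = "{y + t *\<^sub>R \<nu> | y t. y \<in> F \<and> 0 \<le> t \<and> t \<le> 1}"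
  have cp: "closest_point F (y + t *\<^sub>R \<nu>) = y" if y: "y \<in> F" for y and t :: real
  proof (rule closest_point_unique[symmetric, OF F(1,2) y], intro ballI)
    fix y' assume y': "y' \<in> F"
    have "orthogonal (t *\<^sub>R \<nu>) (y - y')"
      using F(3)[OF y] F(3)[OF y'] by (simp add: orthogonal_def inner_diff_right)
    then have "(norm (t *\<^sub>R \<nu> + (y - y')))\<^sup>2 = (norm (t *\<^sub>R \<nu>))\<^sup>2 + (norm (y - y'))\<^sup>2"
      by (rule norm_add_Pythagorean)
    then have "norm (t *\<^sub>R \<nu>) \<le> norm (t *\<^sub>R \<nu> + (y - y'))"
      by (metis le_add_same_cancel1 norm_ge_zero power2_le_imp_le zero_le_power2)
    then show "dist (y + t *\<^sub>R \<nu>) y \<le> dist (y + t *\<^sub>R \<nu>) y'"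
      by (simp add: dist_norm algebra_simps)
  qed
  have "indicator ?Q z * g (closest_point F z) = indicator {0..1} (\<nu> \<bullet> z - b) *
      (indicator F (z - (\<nu> \<bullet> z - b) *\<^sub>R \<nu>) * g (z - (\<nu> \<bullet> z - b) *\<^sub>R \<nu>))" for z
  proof (cases "z \<in> ?Q")
    case True
    then obtain y t where z: "z = y + t *\<^sub>R \<nu>" and y: "y \<in> F" and t: "0 \<le> t" "t \<le> 1" by blast
    have "\<nu> \<bullet> z - b = t" using F(3)[OF y] \<nu>1 by (simp add: z inner_add_right)
    then show ?thesis using True cp[OF y] y t by (simp add: z)
  next
    case False
    have "z = (z - (\<nu> \<bullet> z - b) *\<^sub>R \<nu>) + (\<nu> \<bullet> z - b) *\<^sub>R \<nu>" by simp
    then have "\<not> (z - (\<nu> \<bullet> z - b) *\<^sub>R \<nu> \<in> F \<and> \<nu> \<bullet> z - b \<in> {0..1})"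
      using False by (metis (mono_tags, lifting) atLeastAtMost_iff mem_Collect_eq)
    then show ?thesis using False by (auto simp del: mem_Collect_eq split: split_indicator)
  qed
  then show ?thesis
    by (simp add: facet_integral_def slab_integral_def set_lebesgue_integral_def)
qed

text \<open>The slab of \<open>a\<close> has thickness \<open>1 / norm a\<close> while the prism of
  \<open>facet_integral\<close> has height 1, hence the factor. The minus sign anticipates the use:
  \<open>a\<close> will be the gradient of a barycentric coordinate that vanishes on
  \<open>F\<close>, which points into the simplex.\<close>

lemma facet_integral_slab:
  fixes F :: "(real ^ 'd) set"
  assumes F: "convex F" "compact F" "\<And>y. y \<in> F \<Longrightarrow> a \<bullet> y = b"
    and ae: "a \<bullet> e = 1" and g: "continuous_on F g"
  shows "facet_integral F (- a /\<^sub>R norm a) g = norm a * slab_integral a b e (\<lambda>y. indicator F y * g y)"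
proof -
  let ?H = "\<lambda>y. indicator F y * g y"
  define r where "r = norm a"
  define \<nu> where "\<nu> = - a /\<^sub>R r"
  have "a \<noteq> 0" using ae by auto
  then have r: "r > 0" by (simp add: r_def)
  have aa: "a \<bullet> a = r * r"
    by (simp add: r_def dot_square_norm power2_eq_square)
  have n: "norm \<nu> = 1" using r by (simp add: \<nu>_def r_def)
  then have nn: "\<nu> \<bullet> \<nu> = 1" by (simp add: dot_square_norm)
  have an: "a \<bullet> \<nu> = - r" using aa r by (simp add: \<nu>_def)
  have "facet_integral F \<nu> g = slab_integral \<nu> (- b / r) \<nu> ?H"
    by (rule facet_integral_unit_slab)
       (use F n r in \<open>auto simp: \<nu>_def compact_imp_closed divide_inverse_commute\<close>)
  also have "\<dots> = r * (LINT z|lborel. indicator {0..1} (a \<bullet> z - b) * ?H (z - (\<nu> \<bullet> z - (- b / r)) *\<^sub>R \<nu>))"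
    using slab_integral_window[OF nn, of a b ?H "- b / r"] r an
      integrable_slab_continuous[of a \<nu> F g b \<nu> "- b / r"] F g by simp
  \<comment> \<open>\<open>a /\<^sub>R (r * r)\<close> is the multiple of \<open>a\<close> whose
    inner product with \<open>a\<close> is 1. Projecting along it is orthogonal projection onto the
    hyperplane, just as with the unit vector \<open>\<nu>\<close>.\<close>
  also have "\<dots> = r * slab_integral a b (a /\<^sub>R (r * r)) ?H"
  proof -
    have "(\<nu> \<bullet> z - (- b / r)) *\<^sub>R \<nu> = (a \<bullet> z - b) *\<^sub>R (a /\<^sub>R (r * r))" for z
    proof -
      have "\<nu> \<bullet> z - (- b / r) = - ((a \<bullet> z - b) / r)"
        using r by (simp add: \<nu>_def field_simps)
      then show ?thesis using r by (simp add: \<nu>_def divide_inverse)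
    qed
    then show ?thesis by (simp add: slab_integral_def)
  qed
  also have "slab_integral a b (a /\<^sub>R (r * r)) ?H = slab_integral a b e ?H"
    by (rule slab_integral_direction[OF _ ae cutoff_continuous_compact(1)[OF F(2) g]])
       (use aa r in \<open>simp add: field_simps\<close>)
  finally show ?thesis by (simp add: \<nu>_def r_def)
qed

section \<open>Barycentric coordinates of a simplex\<close>

text \<open>Barycentric coordinates are kept as affine functions on the whole space, with constant
  gradient \<open>a c\<close>. Membership in the simplex and its facets becomes a matter of signs,
  and \<open>a c\<close> is an inward normal of the facet opposite \<open>c\<close>.\<close>

locale barycentric_frame =
  fixes C :: "'a::euclidean_space set" and a :: "'a \<Rightarrow> 'a" and b :: "'a \<Rightarrow> real"
  assumes finite_vertices: "finite C"
    and coord_vertex: "\<And>c c'. c \<in> C \<Longrightarrow> c' \<in> C \<Longrightarrow> a c \<bullet> c' - b c = (if c = c' then 1 else 0)"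
    and affine_hull_vertices: "affine hull C = UNIV"
begin

abbreviation coord :: "'a \<Rightarrow> 'a \<Rightarrow> real" where
  "coord c x \<equiv> a c \<bullet> x - b c"

lemma coord_combination:
  assumes "c \<in> C" "sum u C = 1"
  shows "coord c (\<Sum>c'\<in>C. u c' *\<^sub>R c') = u c"
proof -
  have "coord c (\<Sum>c'\<in>C. u c' *\<^sub>R c') = (\<Sum>c'\<in>C. u c' * (a c \<bullet> c')) - (\<Sum>c'\<in>C. u c') * b c"
    using assms by (simp add: inner_sum_right)
  also have "\<dots> = (\<Sum>c'\<in>C. u c' * coord c c')"
    by (simp add: sum_distrib_right sum_subtractf right_diff_distrib)
  also have "\<dots> = (\<Sum>c'\<in>C. if c = c' then u c' else 0)"
    using assms coord_vertex by (intro sum.cong) auto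
  also have "\<dots> = u c" using assms finite_vertices by simp
  finally show ?thesis .
qed

lemma sum_coord: "(\<Sum>c\<in>C. coord c x) = 1"
  and sum_coord_vertex: "(\<Sum>c\<in>C. coord c x *\<^sub>R c) = x"
proof -
  obtain u where u: "sum u C = 1" "(\<Sum>c\<in>C. u c *\<^sub>R c) = x"
    using affine_hull_vertices affine_hull_finite[OF finite_vertices] by blast
  have "coord c x = u c" if "c \<in> C" for c
    using coord_combination[OF that u(1)] u(2) by simp
  then show "(\<Sum>c\<in>C. coord c x) = 1" "(\<Sum>c\<in>C. coord c x *\<^sub>R c) = x"
    using u by simp_all
qed

text \<open>These are the linear parts of the two affine identities for \<open>coord\<close>,
  obtained by subtracting their values at 0 from those at \<open>e\<close>.\<close>

lemma sum_coord_gradient: "(\<Sum>c\<in>C. a c \<bullet> e) = 0"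
  and sum_coord_gradient_vertex: "(\<Sum>c\<in>C. (a c \<bullet> e) *\<^sub>R c) = e"
proof -
  have "(\<Sum>c\<in>C. a c \<bullet> e) = (\<Sum>c\<in>C. coord c e) - (\<Sum>c\<in>C. coord c 0)"
    by (simp add: sum_subtractf[symmetric])
  then show "(\<Sum>c\<in>C. a c \<bullet> e) = 0" by (simp only: sum_coord)
  have "(\<Sum>c\<in>C. (a c \<bullet> e) *\<^sub>R c) = (\<Sum>c\<in>C. coord c e *\<^sub>R c) - (\<Sum>c\<in>C. coord c 0 *\<^sub>R c)"
    unfolding sum_subtractf[symmetric] scaleR_left_diff_distrib[symmetric] by simp
  then show "(\<Sum>c\<in>C. (a c \<bullet> e) *\<^sub>R c) = e" by (simp only: sum_coord_vertex diff_0_right)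
qed

lemma mem_simplex: "x \<in> convex hull C \<longleftrightarrow> (\<forall>c\<in>C. 0 \<le> coord c x)"
proof
  assume "x \<in> convex hull C"
  then obtain u where "\<forall>c\<in>C. 0 \<le> u c" "sum u C = 1" "(\<Sum>c\<in>C. u c *\<^sub>R c) = x"
    unfolding convex_hull_finite[OF finite_vertices] by blast
  then show "\<forall>c\<in>C. 0 \<le> coord c x" using coord_combination by metis
next
  assume "\<forall>c\<in>C. 0 \<le> coord c x"
  then show "x \<in> convex hull C"
    unfolding convex_hull_finite[OF finite_vertices] using sum_coord sum_coord_vertex
    by (intro CollectI exI[of _ "\<lambda>c. coord c x"]) auto
qed

lemma mem_facet:
  assumes c: "c \<in> C"
  shows "x \<in> convex hull (C - {c}) \<longleftrightarrow> x \<in> convex hull C \<and> coord c x = 0"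
proof
  assume x: "x \<in> convex hull (C - {c})"
  have "convex {x. coord c x = 0}"
    using convex_hyperplane[of "a c" "b c"] by simp
  moreover have "C - {c} \<subseteq> {x. coord c x = 0}" using coord_vertex[OF c] by force
  ultimately have "convex hull (C - {c}) \<subseteq> {x. coord c x = 0}" by (simp add: hull_minimal)
  moreover have "convex hull (C - {c}) \<subseteq> convex hull C" by (rule hull_mono) auto
  ultimately show "x \<in> convex hull C \<and> coord c x = 0" using x by auto
next
  assume x: "x \<in> convex hull C \<and> coord c x = 0"
  have "(\<Sum>c'\<in>C - {c}. coord c' x) = 1"
    using sum.remove[OF finite_vertices c, of "\<lambda>c. coord c x"] x sum_coord[of x] by simp
  moreover have "(\<Sum>c'\<in>C - {c}. coord c' x *\<^sub>R c') = x"
    using sum.remove[OF finite_vertices c, of "\<lambda>c. coord c x *\<^sub>R c"] x sum_coord_vertex[of x] by simp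
  ultimately show "x \<in> convex hull (C - {c})"
    using x finite_vertices mem_simplex
    by (subst convex_hull_finite) (auto intro!: exI[of _ "\<lambda>c. coord c x"])
qed

lemma gradient_edge:
  assumes "c \<in> C" "c1 \<in> C" "c2 \<in> C"
  shows "a c \<bullet> (c1 - c2) = (if c = c1 then 1 else 0) - (if c = c2 then 1 else 0)"
  using coord_vertex[OF assms(1,2)] coord_vertex[OF assms(1,3)] by (simp add: inner_diff_right)

lemma compact_facet: "compact (convex hull (C - {c}))"
  using finite_vertices by (simp add: finite_imp_compact_convex_hull)

lemma compact_simplex: "compact (convex hull C)"
  using finite_vertices by (simp add: finite_imp_compact_convex_hull)

text \<open>
  An edge is parallel to every facet except the two opposite its end points, so a line in its
  direction enters and leaves the simplex through these two facets.
\<close>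

lemma integral_edge_line:
  fixes g :: "'a \<Rightarrow> real"
  assumes c: "c1 \<in> C" "c2 \<in> C" "c1 \<noteq> c2" and y0: "coord c1 y = 0"
    and der: "\<And>x. x \<in> convex hull C \<Longrightarrow> (g has_derivative G x) (at x within convex hull C)"
    and cont: "continuous_on (convex hull C) (\<lambda>x. G x (c1 - c2))"
  shows "(LINT s|lborel. indicator (convex hull C) (y + s *\<^sub>R (c1 - c2)) * G (y + s *\<^sub>R (c1 - c2)) (c1 - c2))
    = indicator (convex hull (C - {c2})) (y + coord c2 y *\<^sub>R (c1 - c2)) * g (y + coord c2 y *\<^sub>R (c1 - c2))
      - indicator (convex hull (C - {c1})) y * g y"
proof -
  let ?D = "convex hull C"
  define e where "e = c1 - c2"
  define l where "l = coord c2 y"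
  have coord_line: "coord c (y + s *\<^sub>R e) =
      coord c y + s * ((if c = c1 then 1 else 0) - (if c = c2 then 1 else 0))" if "c \<in> C" for c s
    using gradient_edge[OF that c(1,2)] by (simp add: e_def inner_add_right)
  \<comment> \<open>The line starts on the hyperplane opposite \<open>c1\<close>, so its parameter
    is itself the coordinate of \<open>c1\<close>. It reaches the hyperplane opposite
    \<open>c2\<close> at \<open>s = l\<close>, and all other coordinates stay constant.\<close>
  have c1s: "coord c1 (y + s *\<^sub>R e) = s" for s
    using coord_line[OF c(1), of s] c(3) y0 by simp
  have c2s: "coord c2 (y + s *\<^sub>R e) = l - s" for s
    using coord_line[OF c(2), of s] c(3) by (simp add: l_def)
  have mem: "y + s *\<^sub>R e \<in> ?D \<longleftrightarrow> 0 \<le> s \<and> s \<le> l \<and> (\<forall>c\<in>C - {c1, c2}. 0 \<le> coord c y)" for s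
  proof -
    have "y + s *\<^sub>R e \<in> ?D \<longleftrightarrow> 0 \<le> coord c1 (y + s *\<^sub>R e) \<and> 0 \<le> coord c2 (y + s *\<^sub>R e)
        \<and> (\<forall>c\<in>C - {c1, c2}. 0 \<le> coord c (y + s *\<^sub>R e))"
      unfolding mem_simplex using c by blast
    moreover have "coord c (y + s *\<^sub>R e) = coord c y" if "c \<in> C - {c1, c2}" for c
      using coord_line[of c s] that by auto
    ultimately show ?thesis unfolding c1s c2s by auto
  qed
  have F1: "y \<in> convex hull (C - {c1}) \<longleftrightarrow> y + 0 *\<^sub>R e \<in> ?D"
    using mem_facet[OF c(1), of y] y0 by simp
  have F2: "y + l *\<^sub>R e \<in> convex hull (C - {c2}) \<longleftrightarrow> y + l *\<^sub>R e \<in> ?D"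
    using mem_facet[OF c(2), of "y + l *\<^sub>R e"] c2s[of l] by simp
  show ?thesis
  proof (cases "0 \<le> l \<and> (\<forall>c\<in>C - {c1, c2}. 0 \<le> coord c y)")
    case True
    have seg: "y + s *\<^sub>R e \<in> ?D \<longleftrightarrow> s \<in> {0..l}" for s
      using mem[of s] True by auto
    have "(LINT s|lborel. indicator {0..l} s *\<^sub>R G (y + s *\<^sub>R e) e) = g (y + l *\<^sub>R e) - g (y + 0 *\<^sub>R e)"
    proof (rule integral_FTC_atLeastAtMost)
      show "0 \<le> l" using True by simp
      have lin: "(\<lambda>s. y + s *\<^sub>R e) ` {0..l} \<subseteq> ?D" using seg by blast
      fix s assume s: "0 \<le> s" "s \<le> l"
      \<comment> \<open>The derivative is given within the simplex only. Along the line it becomes a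
        derivative within \<open>{0..l}\<close>, one-sided at the ends, which is the form that the
        fundamental theorem of calculus takes.\<close>
      have d: "(g has_derivative G (y + s *\<^sub>R e)) (at (y + s *\<^sub>R e) within (\<lambda>s. y + s *\<^sub>R e) ` {0..l})"
        by (rule has_derivative_subset[OF der lin]) (use seg s in auto)
      have "((\<lambda>s. y + s *\<^sub>R e) has_derivative (\<lambda>h. h *\<^sub>R e)) (at s within {0..l})"
        by (auto intro!: derivative_eq_intros)
      from has_derivative_in_compose[OF this d]
      have "((\<lambda>s. g (y + s *\<^sub>R e)) has_derivative (\<lambda>h. G (y + s *\<^sub>R e) (h *\<^sub>R e))) (at s within {0..l})" .
      moreover have "G (y + s *\<^sub>R e) (h *\<^sub>R e) = h *\<^sub>R G (y + s *\<^sub>R e) e" for h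
        using has_derivative_linear[OF d] by (simp add: linear_cmul)
      ultimately show "((\<lambda>s. g (y + s *\<^sub>R e)) has_vector_derivative G (y + s *\<^sub>R e) e) (at s within {0..l})"
        by (simp add: has_vector_derivative_def)
    next
      have cont_e: "continuous_on ?D (\<lambda>x. G x e)"
        using cont by (simp only: e_def)
      have lin_cont: "continuous_on {0..l} (\<lambda>s. y + s *\<^sub>R e)"
        by (intro continuous_intros)
      have lin: "(\<lambda>s. y + s *\<^sub>R e) ` {0..l} \<subseteq> ?D" using seg by blast
      show "continuous_on {0..l} (\<lambda>s. G (y + s *\<^sub>R e) e)"
        by (rule continuous_on_compose2[OF cont_e lin_cont lin])
    qed
    moreover have "indicator ?D (y + s *\<^sub>R e) = (indicator {0..l} s :: real)" for s
      using seg by (auto simp: indicator_def)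
    moreover have "y + l *\<^sub>R e \<in> ?D" "y \<in> ?D"
      using seg[of l] seg[of 0] True by auto
    ultimately show ?thesis
      using F1 F2 by (simp add: e_def[symmetric] l_def[symmetric])
  next
    case False
    then have out: "y + s *\<^sub>R e \<notin> ?D" for s using mem[of s] by auto
    from out[of 0] have "y \<notin> ?D" by simp
    with out show ?thesis
      using F1 F2 by (simp add: e_def[symmetric] l_def[symmetric])
  qed
qed

text \<open>The line formula is integrated over the slab of \<open>c1\<close>. The entry facet
  already appears there as its own slab integral; the exit facet is transferred to the slab of
  \<open>c2\<close>.\<close>

lemma integral_simplex_edge:
  fixes g :: "'a \<Rightarrow> real"
  assumes c: "c1 \<in> C" "c2 \<in> C" "c1 \<noteq> c2"
    and der: "\<And>x. x \<in> convex hull C \<Longrightarrow> (g has_derivative G x) (at x within convex hull C)"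
    and cont: "continuous_on (convex hull C) (\<lambda>x. G x (c1 - c2))"
  shows "(LINT x:convex hull C|lborel. G x (c1 - c2))
    = slab_integral (a c2) (b c2) (c2 - c1) (\<lambda>y. indicator (convex hull (C - {c2})) y * g y)
      - slab_integral (a c1) (b c1) (c1 - c2) (\<lambda>y. indicator (convex hull (C - {c1})) y * g y)"
proof -
  let ?D = "convex hull C"
  let ?H = "\<lambda>c y. indicator (convex hull (C - {c})) y * g y"
  define e where "e = c1 - c2"
  have ae: "a c1 \<bullet> e = 1" "a c2 \<bullet> - e = 1" "a c1 \<bullet> - e = - 1"
    using gradient_edge[OF c(1) c(1,2)] gradient_edge[OF c(2) c(1,2)] c(3)
    by (simp_all only: e_def inner_minus_right) simp_all
  have gc: "continuous_on (convex hull (C - {c})) g" for c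
    using der has_derivative_continuous_on continuous_on_subset hull_mono[of "C - {c}" C convex]
    by (metis Diff_subset)
  have int: "integrable lborel (\<lambda>x. indicator ?D x * G x e)"
    using borel_integrable_compact[OF compact_simplex cont] by (simp add: e_def)
  have line: "(LINT t|lborel. indicator ?D (z + t *\<^sub>R e) * G (z + t *\<^sub>R e) e)
      = ?H c2 (z - coord c2 z *\<^sub>R (- e)) - ?H c1 (z - coord c1 z *\<^sub>R e)" for z
  proof -
    \<comment> \<open>The origin of the line through \<open>z\<close> is moved to the hyperplane
      opposite \<open>c1\<close>, where \<open>integral_edge_line\<close> applies.\<close>
    define y where "y = z - coord c1 z *\<^sub>R e"
    let ?k = "\<lambda>s. indicator ?D (y + s *\<^sub>R e) * G (y + s *\<^sub>R e) e"
    have y0: "coord c1 y = 0" using ae by (simp add: y_def inner_diff_right)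
    have "a c2 \<bullet> e = - 1" using ae(2) by simp
    then have c2y: "y + coord c2 y *\<^sub>R e = z - coord c2 z *\<^sub>R (- e)"
      by (simp add: y_def inner_diff_right algebra_simps)
    have "(LINT t|lborel. ?k t) = (LINT t|lborel. ?k (coord c1 z + 1 * t))"
      using lborel_integral_real_affine[of 1 ?k "coord c1 z"] by simp
    also have "\<dots> = (LINT t|lborel. indicator ?D (z + t *\<^sub>R e) * G (z + t *\<^sub>R e) e)"
      by (simp add: y_def algebra_simps)
    finally show ?thesis
      using integral_edge_line[OF c y0 der cont] c2y by (simp add: e_def[symmetric] y_def[symmetric])
  qed
  have int1: "integrable lborel (\<lambda>z. indicator {0..1} (coord c1 z) * ?H c1 (z - coord c1 z *\<^sub>R e))"
    by (rule integrable_slab_continuous) (use ae gc compact_facet in auto)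
  have int2: "integrable lborel (\<lambda>z. indicator {0..1} (coord c1 z) * ?H c2 (z - coord c2 z *\<^sub>R (- e)))"
    by (rule integrable_slab_continuous) (use ae gc compact_facet in auto)
  have "(LINT x:?D|lborel. G x e) = (LINT x|lborel. indicator ?D x * G x e)"
    by (simp add: set_lebesgue_integral_def)
  also have "\<dots> = (LINT z|lborel. indicator {0..1} (coord c1 z)
      * (?H c2 (z - coord c2 z *\<^sub>R (- e)) - ?H c1 (z - coord c1 z *\<^sub>R e)))"
    unfolding line[symmetric] by (rule integral_slab_lines[OF ae(1) int])
  also have "\<dots> = (LINT z|lborel. indicator {0..1} (coord c1 z) * ?H c2 (z - coord c2 z *\<^sub>R (- e)))
      - (LINT z|lborel. indicator {0..1} (coord c1 z) * ?H c1 (z - coord c1 z *\<^sub>R e))"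
    using Bochner_Integration.integral_diff[OF int2 int1] by (simp only: right_diff_distrib)
  \<comment> \<open>The change of slab costs the factor
    \<open>\<bar>a c1 \<bullet> - e\<bar> = 1\<close>. The direction for \<open>c2\<close> is
    \<open>- e\<close> because \<open>coord c2\<close> decreases along \<open>e\<close>.\<close>
  also have "\<dots> = slab_integral (a c2) (b c2) (- e) (?H c2) - slab_integral (a c1) (b c1) e (?H c1)"
    using slab_integral_window[OF ae(2) _ int2] ae(3) unfolding slab_integral_def[of "a c1"] by simp
  finally show ?thesis by (simp add: e_def)
qed

end

lemma ex_barycentric_frame:
  fixes C :: "'a::euclidean_space set"
  assumes C: "\<not> affine_dependent C" "card C = Suc DIM('a)"
  shows "\<exists>a b. barycentric_frame C a b"
proof -
  have fin: "finite C" using C(1) aff_independent_finite by blast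
  have "\<exists>a b. \<forall>c'\<in>C. a \<bullet> c' - b = (if c = c' then 1 else 0 :: real)" if c: "c \<in> C" for c
  proof -
    \<comment> \<open>The origin \<open>c0\<close> must differ from \<open>c\<close>, so that
      \<open>- c0 + c\<close> is among the independent differences on which a linear functional can
      be prescribed. Its representing vector is \<open>adjoint f 1\<close>.\<close>
    have "card (C - {c}) \<noteq> 0" using C c fin by simp
    then have "C - {c} \<noteq> {}" by force
    then obtain c0 where c0: "c0 \<in> C" "c0 \<noteq> c" by blast
    let ?B = "(\<lambda>x. - c0 + x) ` (C - {c0})"
    have "independent ?B" using C(1) affine_dependent_iff_dependent2[OF c0(1)] by blast
    then obtain f :: "'a \<Rightarrow> real" where f: "linear f"
      "\<And>x. x \<in> ?B \<Longrightarrow> f x = (if x = - c0 + c then 1 else 0)"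
      using linear_independent_extend[of ?B "\<lambda>x. if x = - c0 + c then 1 else 0"] by blast
    have adj: "adjoint f 1 \<bullet> x = f x" for x
      using adjoint_works[OF f(1), of x 1] by (simp add: inner_commute)
    have "f c' - f c0 = (if c = c' then 1 else 0)" if c': "c' \<in> C" for c'
    proof (cases "c' = c0")
      case False
      then have "f (- c0 + c') = (if - c0 + c' = - c0 + c then 1 else 0)"
        using c' by (intro f(2)) auto
      then show ?thesis using linear_diff[OF f(1), of c' c0] by auto
    qed (use c0 in auto)
    then show ?thesis
      by (intro exI[of _ "adjoint f 1"] exI[of _ "f c0"]) (simp add: adj)
  qed
  then obtain a b where "\<And>c c'. c \<in> C \<Longrightarrow> c' \<in> C \<Longrightarrow> a c \<bullet> c' - b c = (if c = c' then 1 else 0 :: real)"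
    by metis
  then have "barycentric_frame C a b"
    using fin affine_independent_span_eq[OF C] by unfold_locales auto
  then show ?thesis by blast
qed

section \<open>The divergence theorem on a simplex\<close>

lemma set_integrable_continuous_compact:
  fixes f :: "'a::euclidean_space \<Rightarrow> real"
  assumes "compact D" "continuous_on D f"
  shows "set_integrable lborel D f"
  using borel_integrable_compact[OF assms] by (simp add: set_integrable_def)

lemma facet_integral_mult_right:
  "facet_integral F \<nu> (\<lambda>x. g x * k) = facet_integral F \<nu> g * k"
  by (simp add: facet_integral_def set_integral_mult_left)

section \<open>Outward normals of the facets\<close>

context barycentric_frame
begin

text \<open>Expand \<open>e\<close> in the vertices with coefficients
  \<open>a c' \<bullet> e\<close>. They sum to 0, so \<open>\<beta>\<close> may be subtracted from
  every \<open>\<nu> \<bullet> c'\<close>, and then only the vertex \<open>c\<close>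
  contributes.\<close>

lemma gradient_eq_of_constant:
  assumes c: "c \<in> C" and const: "\<And>c'. c' \<in> C - {c} \<Longrightarrow> \<nu> \<bullet> c' = \<beta>"
  shows "\<nu> = (\<nu> \<bullet> c - \<beta>) *\<^sub>R a c"
proof -
  have "\<nu> \<bullet> e = ((\<nu> \<bullet> c - \<beta>) *\<^sub>R a c) \<bullet> e" for e
  proof -
    have "\<nu> \<bullet> e = \<nu> \<bullet> (\<Sum>c'\<in>C. (a c' \<bullet> e) *\<^sub>R c')"
      by (simp only: sum_coord_gradient_vertex)
    also have "\<dots> = (\<Sum>c'\<in>C. (a c' \<bullet> e) * (\<nu> \<bullet> c')) - (\<Sum>c'\<in>C. a c' \<bullet> e) * \<beta>"
      by (simp add: inner_sum_right sum_coord_gradient)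
    also have "\<dots> = (\<Sum>c'\<in>C. (a c' \<bullet> e) * (\<nu> \<bullet> c' - \<beta>))"
      by (simp add: sum_distrib_right sum_subtractf right_diff_distrib)
    also have "\<dots> = (\<Sum>c'\<in>C. if c = c' then (a c' \<bullet> e) * (\<nu> \<bullet> c' - \<beta>) else 0)"
      using const by (intro sum.cong) auto
    also have "\<dots> = ((\<nu> \<bullet> c - \<beta>) *\<^sub>R a c) \<bullet> e"
      using c finite_vertices by simp
    finally show ?thesis .
  qed
  then show ?thesis by (metis vector_eq_rdot)
qed

lemma gradient_nonzero:
  assumes "c \<in> C" "c' \<in> C" "c \<noteq> c'"
  shows "a c \<noteq> 0"
  using gradient_edge[OF assms(1) assms(1,2)] assms(3) by auto

end

text \<open>For uniqueness, two vertices of the facet also lie in the simplex, so the inequality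
  holds in both directions and \<open>\<nu>\<close> is constant on the facet. Hence
  \<open>\<nu>\<close> is a multiple of \<open>a c\<close>; the norm and the inequality at
  \<open>c\<close> fix the multiple.\<close>

lemma outward_unit_normal_simplex:
  fixes C :: "(real ^ 'd) set"
  assumes "barycentric_frame C a b" and c: "c \<in> C" "c' \<in> C" "c \<noteq> c'"
  shows "outward_unit_normal (convex hull C) (convex hull (C - {c})) = - a c /\<^sub>R norm (a c)"
proof -
  interpret barycentric_frame C a b by fact
  have ac: "a c \<noteq> 0" by (rule gradient_nonzero[OF c])
  show ?thesis
    unfolding outward_unit_normal_def
  proof (rule the_equality, intro conjI ballI)
    show "norm (- a c /\<^sub>R norm (a c)) = 1" using ac by simp
    fix x y assume x: "x \<in> convex hull C" and y: "y \<in> convex hull (C - {c})"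
    have "a c \<bullet> y \<le> a c \<bullet> x"
      using x y c mem_simplex[of x] mem_facet[of c y] by auto
    then show "(- a c /\<^sub>R norm (a c)) \<bullet> x \<le> (- a c /\<^sub>R norm (a c)) \<bullet> y"
      by (simp add: mult_left_mono)
  next
    fix \<nu> assume \<nu>: "norm \<nu> = 1 \<and> (\<forall>x\<in>convex hull C. \<forall>y\<in>convex hull (C - {c}). \<nu> \<bullet> x \<le> \<nu> \<bullet> y)"
    have inF: "z \<in> convex hull (C - {c})" if "z \<in> C - {c}" for z using that by (rule hull_inc)
    have inD: "z \<in> convex hull C" if "z \<in> C" for z using that by (rule hull_inc)
    have "\<nu> \<bullet> z = \<nu> \<bullet> c'" if z: "z \<in> C - {c}" for z
      using \<nu> inF[OF z] inF[of c'] inD[of z] inD[of c'] z c by (auto intro!: antisym)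
    then have eq: "\<nu> = (\<nu> \<bullet> c - \<nu> \<bullet> c') *\<^sub>R a c"
      using gradient_eq_of_constant[OF c(1)] by blast
    have le: "\<nu> \<bullet> c - \<nu> \<bullet> c' \<le> 0"
      using \<nu> inF[of c'] inD[of c] c by auto
    have "norm \<nu> = \<bar>\<nu> \<bullet> c - \<nu> \<bullet> c'\<bar> * norm (a c)"
      by (subst eq) simp
    then have "- (\<nu> \<bullet> c - \<nu> \<bullet> c') * norm (a c) = 1" using \<nu> le by simp
    then have "\<nu> \<bullet> c - \<nu> \<bullet> c' = - 1 / norm (a c)" using ac by (simp add: field_simps)
    then show "\<nu> = - a c /\<^sub>R norm (a c)" by (subst eq) (simp add: divide_inverse)
  qed
qed

lemma divergence_simplex:
  fixes g :: "real ^ 'd \<Rightarrow> real"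
  assumes D: "int CARD('d) simplex D"
    and der: "\<And>x. x \<in> D \<Longrightarrow> (g has_derivative G x) (at x within D)"
    and cont: "\<And>e. continuous_on D (\<lambda>x. G x e)"
  shows "boundary_integral D (\<lambda>x \<nu>. g x * (\<nu> $ m)) = (LINT x:D|lborel. G x (axis m 1))"
proof -
  obtain C where C: "\<not> affine_dependent C" "card C = Suc DIM(real ^ 'd)" and DC: "D = convex hull C"
    using D by (auto simp: simplex_def)
  obtain a b where frame: "barycentric_frame C a b"
    using ex_barycentric_frame[OF C] by blast
  interpret barycentric_frame C a b by (rule frame)
  have card2: "2 \<le> card C" using C(2) by simp
  have other: "\<exists>c'\<in>C. c' \<noteq> c" for c
  proof (rule ccontr)
    assume "\<not> ?thesis"
    then have "C \<subseteq> {c}" by auto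
    then have "card C \<le> 1" using card_mono[of "{c}" C] by simp
    then show False using card2 by simp
  qed
  have gc: "continuous_on (convex hull (C - {c})) g" for c
    using der has_derivative_continuous_on continuous_on_subset hull_mono[of "C - {c}" C convex] DC
    by (metis Diff_subset)
  define nu where "nu c = - a c /\<^sub>R norm (a c)" for c
  \<comment> \<open>By \<open>facet_integral_slab\<close>, this quotient is the slab integral of the
    facet opposite \<open>c\<close>, with the same value for every edge at \<open>c\<close>.
    Integrals in edge directions thereby become differences of one quantity per vertex.\<close>
  define K where "K c = facet_integral (convex hull (C - {c})) (nu c) g / norm (a c)" for c
  have K: "slab_integral (a c) (b c) (c - c') (\<lambda>y. indicator (convex hull (C - {c})) y * g y) = K c"
    if c: "c \<in> C" "c' \<in> C" "c \<noteq> c'" for c c'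
  proof -
    have "a c \<bullet> (c - c') = 1" using gradient_edge[OF c(1) c(1,2)] c(3) by simp
    then show ?thesis
      using facet_integral_slab[OF convex_convex_hull compact_facet[of c], where a = "a c" and b = "b c" and g = g]
        gc mem_facet[OF c(1)] gradient_nonzero[OF c] by (simp add: K_def nu_def)
  qed
  have edge: "(LINT x:D|lborel. G x (c1 - c2)) = K c2 - K c1" if c: "c1 \<in> C" "c2 \<in> C" for c1 c2
  proof (cases "c1 = c2")
    case True
    have "indicator D x *\<^sub>R G x 0 = 0" for x
      using linear_0[OF has_derivative_linear[OF der[of x]]] by (cases "x \<in> D") auto
    then have "(LINT x:D|lborel. G x 0) = 0"
      by (simp only: set_lebesgue_integral_def Bochner_Integration.integral_zero)
    then show ?thesis using True by simp
  next
    case False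
    then show ?thesis
      using integral_simplex_edge[OF c False, of g G] der cont K[OF c(2,1)] K[OF c] by (simp add: DC)
  qed
  let ?e = "axis m 1 :: real ^ 'd"
  obtain c0 where c0: "c0 \<in> C" using other by blast
  have "(LINT x:D|lborel. G x ?e) = (LINT x:D|lborel. \<Sum>c\<in>C. (a c \<bullet> ?e) * G x (c - c0))"
  proof (rule set_lebesgue_integral_cong)
    show "D \<in> sets lborel" using compact_simplex by (simp add: DC borel_compact)
    \<comment> \<open>The coefficients sum to 0, so subtracting \<open>c0\<close> from each vertex
      leaves the expansion unchanged and makes every term an edge direction (or 0).\<close>
    have e: "?e = (\<Sum>c\<in>C. (a c \<bullet> ?e) *\<^sub>R (c - c0))"
      using sum_coord_gradient_vertex[of ?e] sum_coord_gradient[of ?e]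
      by (simp add: scaleR_right_diff_distrib sum_subtractf scaleR_left.sum[symmetric])
    show "\<forall>x. x \<in> D \<longrightarrow> G x ?e = (\<Sum>c\<in>C. (a c \<bullet> ?e) * G x (c - c0))"
    proof (intro allI impI)
      fix x assume "x \<in> D"
      then have lin: "linear (G x)" by (rule has_derivative_linear[OF der])
      have "G x ?e = G x (\<Sum>c\<in>C. (a c \<bullet> ?e) *\<^sub>R (c - c0))" by (simp only: e[symmetric])
      also have "\<dots> = (\<Sum>c\<in>C. (a c \<bullet> ?e) * G x (c - c0))"
        using lin by (simp add: linear_sum linear_cmul)
      finally show "G x ?e = (\<Sum>c\<in>C. (a c \<bullet> ?e) * G x (c - c0))" .
    qed
  qed
  also have "\<dots> = (\<Sum>c\<in>C. LINT x:D|lborel. (a c \<bullet> ?e) * G x (c - c0))"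
  proof -
    have "integrable lborel (\<lambda>x. indicator D x *\<^sub>R ((a c \<bullet> ?e) * G x (c - c0)))" for c
      by (rule borel_integrable_compact)
         (use compact_simplex cont in \<open>auto simp: DC intro!: continuous_intros\<close>)
    then show ?thesis
      unfolding set_lebesgue_integral_def scaleR_sum_right by (rule Bochner_Integration.integral_sum)
  qed
  also have "\<dots> = (\<Sum>c\<in>C. (a c \<bullet> ?e) * (LINT x:D|lborel. G x (c - c0)))"
    by simp
  also have "\<dots> = (\<Sum>c\<in>C. (a c \<bullet> ?e) * (K c0 - K c))"
    using edge c0 by simp
  also have "\<dots> = (\<Sum>c\<in>C. a c \<bullet> ?e) * K c0 - (\<Sum>c\<in>C. (a c \<bullet> ?e) * K c)"
    by (simp add: right_diff_distrib sum_subtractf sum_distrib_right)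
  \<comment> \<open>The auxiliary vertex drops out for the same reason. The remaining factor
    \<open>- (a c \<bullet> ?e) / norm (a c)\<close> is the component of the outward normal.\<close>
  also have "\<dots> = (\<Sum>c\<in>C. - (a c \<bullet> ?e) * K c)"
    by (simp add: sum_coord_gradient sum_negf)
  also have "\<dots> = (\<Sum>c\<in>C. facet_integral (convex hull (C - {c})) (nu c) (\<lambda>x. g x * nu c $ m))"
    unfolding facet_integral_mult_right
    by (intro sum.cong) (auto simp: K_def nu_def inner_axis divide_inverse)
  also have "\<dots> = (\<Sum>c\<in>C. (\<lambda>F. let \<nu> = outward_unit_normal D F in facet_integral F \<nu> (\<lambda>x. g x * \<nu> $ m))
      (convex hull (C - {c})))"
  proof (rule sum.cong[OF refl])
    fix c assume "c \<in> C"
    then have "outward_unit_normal D (convex hull (C - {c})) = nu c"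
      using outward_unit_normal_simplex[OF frame] other unfolding nu_def DC by metis
    then show "facet_integral (convex hull (C - {c})) (nu c) (\<lambda>x. g x * nu c $ m) =
        (\<lambda>F. let \<nu> = outward_unit_normal D F in facet_integral F \<nu> (\<lambda>x. g x * \<nu> $ m))
          (convex hull (C - {c}))"
      by (simp add: Let_def)
  qed
  also have "\<dots> = boundary_integral D (\<lambda>x \<nu>. g x * \<nu> $ m)"
  proof -
    have inj: "inj_on (\<lambda>c. convex hull (C - {c})) C"
    proof (rule inj_onI, rule ccontr)
      fix c c' assume c: "c \<in> C" "c' \<in> C" "convex hull (C - {c}) = convex hull (C - {c'})" "c \<noteq> c'"
      have "c \<in> convex hull (C - {c'})" using c by (intro hull_inc) auto
      then have "coord c c = 0" using c(1,3) mem_facet by blast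
      then show False using coord_vertex[OF c(1,1)] by simp
    qed
    have "{F. F facet_of D} = (\<lambda>c. convex hull (C - {c})) ` C"
      unfolding DC facet_of_convex_hull_affine_independent_alt[OF C(1)] using card2 by auto
    then show ?thesis
      unfolding boundary_integral_def by (simp add: sum.reindex[OF inj])
  qed
  finally show ?thesis by simp
qed

lemma interior_simplex:
  fixes D :: "(real ^ 'd) set"
  assumes "int CARD('d) simplex D"
  shows "interior D \<noteq> {}"
proof -
  obtain C where C: "\<not> affine_dependent C" "card C = Suc DIM(real ^ 'd)" and D: "D = convex hull C"
    using assms by (auto simp: simplex_def)
  have "affine hull D = UNIV"
    using affine_independent_span_eq[OF C] by (simp add: D)
  then have "rel_interior D = interior D" by (rule rel_interior_interior)
  moreover have "D \<noteq> {}" "convex D" using C(2) D by auto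
  ultimately show ?thesis using rel_interior_eq_empty by metis
qed

section \<open>Polynomials and their \<open>L\<^sup>2\<close> projection\<close>

lemma finite_multi_indices: "finite {\<alpha> :: 'd::finite \<Rightarrow> nat. sum \<alpha> UNIV \<le> N}"
proof (rule finite_subset)
  show "{\<alpha> :: 'd \<Rightarrow> nat. sum \<alpha> UNIV \<le> N} \<subseteq> PiE UNIV (\<lambda>_. {..N})"
  proof
    fix \<alpha> :: "'d \<Rightarrow> nat" assume "\<alpha> \<in> {\<alpha>. sum \<alpha> UNIV \<le> N}"
    moreover have "\<alpha> i \<le> sum \<alpha> UNIV" for i by (rule member_le_sum) auto
    ultimately have "\<alpha> i \<le> N" for i using order_trans by blast
    then show "\<alpha> \<in> PiE UNIV (\<lambda>_. {..N})" by auto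
  qed
  show "finite (PiE (UNIV :: 'd set) (\<lambda>_. {..N}))" by (intro finite_PiE) auto
qed

lemma poly_space_diff:
  assumes "p \<in> poly_space N" "q \<in> poly_space N"
  shows "(\<lambda>x. p x - q x) \<in> poly_space N"
proof -
  obtain c d where c: "p = (\<lambda>x. \<Sum>\<alpha> | sum \<alpha> UNIV \<le> N. c \<alpha> * (\<Prod>i\<in>UNIV. (x $ i) ^ \<alpha> i))"
    and d: "q = (\<lambda>x. \<Sum>\<alpha> | sum \<alpha> UNIV \<le> N. d \<alpha> * (\<Prod>i\<in>UNIV. (x $ i) ^ \<alpha> i))"
    using assms by (auto simp: poly_space_def)
  show ?thesis unfolding poly_space_def c d
    by (intro CollectI exI[of _ "\<lambda>\<alpha>. c \<alpha> - d \<alpha>"]) (simp add: sum_subtractf left_diff_distrib)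
qed

lemma poly_space_C1:
  assumes "p \<in> poly_space N"
  shows "\<exists>P. \<forall>x. (p has_derivative P x) (at x) \<and> (\<forall>e. continuous_on UNIV (\<lambda>x. P x e))"
proof -
  obtain c where c: "p = (\<lambda>x. \<Sum>\<alpha> | sum \<alpha> UNIV \<le> N. c \<alpha> * (\<Prod>i\<in>UNIV. (x $ i) ^ \<alpha> i))"
    using assms by (auto simp: poly_space_def)
  \<comment> \<open>For \<open>\<alpha> i = 0\<close> the truncated exponent is harmless, since the
    factor \<open>of_nat (\<alpha> i)\<close> is 0.\<close>
  define P where "P x h = (\<Sum>\<alpha> | sum \<alpha> UNIV \<le> N. c \<alpha> *
      (\<Sum>i\<in>UNIV. (of_nat (\<alpha> i) * (h $ i) * (x $ i) ^ (\<alpha> i - 1)) * (\<Prod>j\<in>UNIV - {i}. (x $ j) ^ \<alpha> j)))"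
    for x h :: "real ^ 'a"
  have nth: "((\<lambda>x. x $ i) has_derivative (\<lambda>h. h $ i)) (at x)" for i :: 'a and x :: "real ^ 'a"
    by (rule bounded_linear_imp_has_derivative[OF bounded_linear_vec_nth])
  have "((\<lambda>x. \<Prod>i\<in>UNIV. (x $ i) ^ \<alpha> i) has_derivative (\<lambda>h. \<Sum>i\<in>UNIV.
      (of_nat (\<alpha> i) * (h $ i) * (x $ i) ^ (\<alpha> i - 1)) * (\<Prod>j\<in>UNIV - {i}. (x $ j) ^ \<alpha> j))) (at x)"
    for \<alpha> and x :: "real ^ 'a"
    by (rule has_derivative_prod) (rule has_derivative_power[OF nth])
  then have "(p has_derivative P x) (at x)" for x
    unfolding c P_def by (intro has_derivative_sum has_derivative_mult_right)
  moreover have "continuous_on UNIV (\<lambda>x. P x e)" for e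
    unfolding P_def by (intro continuous_intros)
  ultimately show ?thesis by blast
qed

lemma poly_space_continuous:
  assumes "p \<in> poly_space N"
  shows "continuous_on D p"
proof -
  obtain P where "\<And>x. (p has_derivative P x) (at x)"
    using poly_space_C1[OF assms] by blast
  then show ?thesis
    by (intro continuous_at_imp_continuous_on ballI has_derivative_continuous)
qed

text \<open>On the line from a point of \<open>S\<close> to \<open>x\<close> the function is a
  univariate polynomial. It vanishes on a nonempty open set of parameters, so it has infinitely many
  roots and is zero; the parameter 1 gives \<open>x\<close>.\<close>

lemma poly_space_eq_0:
  assumes p: "p \<in> poly_space N" and S: "open S" "S \<noteq> {}" "\<And>x. x \<in> S \<Longrightarrow> p x = 0"
  shows "p x = 0"
proof -
  obtain c where c: "p = (\<lambda>x. \<Sum>\<alpha> | sum \<alpha> UNIV \<le> N. c \<alpha> * (\<Prod>i\<in>UNIV. (x $ i) ^ \<alpha> i))"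
    using p by (auto simp: poly_space_def)
  obtain x0 where x0: "x0 \<in> S" using S by blast
  define d where "d = x - x0"
  define q where "q = (\<Sum>\<alpha> | sum \<alpha> UNIV \<le> N. smult (c \<alpha>) (\<Prod>i\<in>UNIV. [:x0 $ i, d $ i:] ^ \<alpha> i))"
  have q: "poly q t = p (x0 + t *\<^sub>R d)" for t
    by (simp add: q_def c poly_sum poly_prod)
  have "open ((\<lambda>t. x0 + t *\<^sub>R d) -` S)"
    by (rule open_vimage[OF S(1)]) (intro continuous_intros)
  moreover have "0 \<in> (\<lambda>t. x0 + t *\<^sub>R d) -` S" using x0 by simp
  ultimately have "infinite ((\<lambda>t. x0 + t *\<^sub>R d) -` S)"
    using finite_imp_not_open by blast
  moreover have "(\<lambda>t. x0 + t *\<^sub>R d) -` S \<subseteq> {t. poly q t = 0}" using S(3) q by auto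
  ultimately have "q = 0" using poly_roots_finite finite_subset by blast
  then show ?thesis using q[of 1] by (simp add: d_def)
qed

section \<open>Existence and uniqueness of the projection, and its vector form\<close>

text \<open>By Gram-Schmidt; the spanning functions may be linearly dependent.\<close>

lemma ex_L2_projection_span:
  fixes \<phi> :: "'i \<Rightarrow> 'a::euclidean_space \<Rightarrow> real"
  assumes D: "compact D" and "finite I" "\<And>i. i \<in> I \<Longrightarrow> continuous_on D (\<phi> i)" "continuous_on D g"
  shows "\<exists>c. \<forall>i\<in>I. (LINT x:D|lborel. (\<Sum>j\<in>I. c j * \<phi> j x) * \<phi> i x) = (LINT x:D|lborel. g x * \<phi> i x)"
  using assms(2-4)
proof (induction I arbitrary: g rule: finite_induct)
  case empty
  then show ?case by simp
next
  case (insert k I)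
  define ip where "ip f h = (LINT x:D|lborel. f x * h x)" for f h :: "'a \<Rightarrow> real"
  have int: "set_integrable lborel D (\<lambda>x. f x * h x)"
    if "continuous_on D f" "continuous_on D h" for f h :: "'a \<Rightarrow> real"
    using that by (intro set_integrable_continuous_compact D continuous_on_mult)
  have ip_add: "ip (\<lambda>x. f x + h x) l = ip f l + ip h l"
    if "continuous_on D f" "continuous_on D h" "continuous_on D l" for f h l
    using set_integral_add(2)[OF int[OF that(1,3)] int[OF that(2,3)]] by (simp add: ip_def distrib_right)
  have ip_scale: "ip (\<lambda>x. s * f x) l = s * ip f l" for s f l
    by (simp add: ip_def mult.assoc)
  have ip_comm: "ip f h = ip h f" for f h by (simp add: ip_def mult.commute)
  have cont: "continuous_on D (\<phi> k)" "\<And>i. i \<in> I \<Longrightarrow> continuous_on D (\<phi> i)"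
    using insert.prems by auto
  have cont_comb: "continuous_on D (\<lambda>x. \<Sum>j\<in>I. c j * \<phi> j x)" for c
    using cont(2) by (intro continuous_intros)
  have ip_comb: "ip (\<lambda>x. \<Sum>j\<in>I. c j * \<phi> j x) l = (\<Sum>j\<in>I. c j * ip (\<phi> j) l)"
    if l: "continuous_on D l" for c l
  proof -
    have "ip (\<lambda>x. \<Sum>j\<in>J. c j * \<phi> j x) l = (\<Sum>j\<in>J. c j * ip (\<phi> j) l)" if "J \<subseteq> I" for J
      using finite_subset[OF that insert.hyps(1)] that
    proof (induction J rule: finite_induct)
      case empty
      then show ?case by (simp add: ip_def)
    next
      case (insert j J)
      then show ?case using cont l
        by (simp add: ip_scale) (subst ip_add, auto simp: ip_scale intro!: continuous_intros)
    qed
    then show ?thesis by blast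
  qed
  \<comment> \<open>The induction hypothesis is used for \<open>\<phi> k\<close> as well as for
    \<open>g\<close>, hence the generalization over \<open>g\<close>. The remainder \<open>r\<close>
    of \<open>\<phi> k\<close> is orthogonal to the earlier functions, so adding a multiple of it to
    \<open>p\<close> keeps the conditions already met.\<close>
  obtain c where c: "\<forall>i\<in>I. ip (\<lambda>x. \<Sum>j\<in>I. c j * \<phi> j x) (\<phi> i) = ip (\<phi> k) (\<phi> i)"
    using insert.IH[OF cont(2,1)] unfolding ip_def by blast
  obtain d where d: "\<forall>i\<in>I. ip (\<lambda>x. \<Sum>j\<in>I. d j * \<phi> j x) (\<phi> i) = ip g (\<phi> i)"
    using insert.IH[OF cont(2) insert.prems(2)] unfolding ip_def by blast
  define q where "q = (\<lambda>x. \<Sum>j\<in>I. c j * \<phi> j x)"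
  define p where "p = (\<lambda>x. \<Sum>j\<in>I. d j * \<phi> j x)"
  define r where "r x = \<phi> k x + (- 1) * q x" for x
  have cq: "continuous_on D q" and cp: "continuous_on D p"
    unfolding q_def p_def by (rule cont_comb)+
  have cr: "continuous_on D r" unfolding r_def by (intro continuous_intros cont cq)
  have r_orth: "ip r (\<phi> i) = 0" if "i \<in> I" for i
  proof -
    have "ip r (\<phi> i) = ip (\<phi> k) (\<phi> i) + ip (\<lambda>x. (- 1) * q x) (\<phi> i)"
      unfolding r_def by (rule ip_add) (intro continuous_intros cont cq that)+
    then show ?thesis using c that by (simp only: ip_scale) (simp add: q_def)
  qed
  text \<open>If \<open>r\<close> is a null function, then both sides vanish and \<open>s = 0\<close> because \<open>x / 0 = 0\<close>.\<close>
  define s where "s = ip g r / ip r r"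
  have s: "s * ip r r = ip g r"
  proof (cases "ip r r = 0")
    case True
    have "(LINT x|lborel. indicator D x *\<^sub>R (r x * r x)) = 0"
      using True by (simp add: ip_def set_lebesgue_integral_def)
    then have "AE x in lborel. indicator D x *\<^sub>R (r x * r x) = 0"
      using int[OF cr cr] by (subst (asm) integral_nonneg_eq_0_iff_AE) (auto simp: set_integrable_def)
    then have "AE x in lborel. indicator D x *\<^sub>R (g x * r x) = 0" by eventually_elim auto
    then have "ip g r = 0"
      unfolding ip_def set_lebesgue_integral_def by (rule integral_eq_zero_AE)
    then show ?thesis using True by simp
  qed (simp add: s_def)
  define new where "new x = p x + s * r x" for x
  have cn: "continuous_on D new" unfolding new_def by (intro continuous_intros cp cr)
  have ip_new: "ip new l = ip p l + s * ip r l" if "continuous_on D l" for l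
    unfolding new_def ip_scale[symmetric] by (rule ip_add) (intro continuous_intros cp cr that)+
  have new_I: "ip new (\<phi> i) = ip g (\<phi> i)" if "i \<in> I" for i
    using ip_new[OF cont(2)[OF that]] r_orth[OF that] d that by (simp add: p_def)
  have "ip p r = 0"
    using ip_comb[OF cr, of d] r_orth by (simp add: p_def ip_comm[of _ r])
  then have new_r: "ip new r = ip g r" using ip_new[OF cr] s by simp
  have new_q: "ip new q = ip g q"
    using ip_comb[OF cn, of c] ip_comb[OF insert.prems(2), of c] new_I
    by (simp add: q_def ip_comm[of _ new] ip_comm[of _ g])
  have new_k: "ip new (\<phi> k) = ip g (\<phi> k)"
  proof -
    have "\<phi> k = (\<lambda>x. r x + q x)" by (simp add: r_def)
    then have "ip l (\<phi> k) = ip r l + ip q l" if "continuous_on D l" for l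
      using ip_add[OF cr cq that] by (simp add: ip_comm[of l])
    then show ?thesis
      using new_r new_q cn insert.prems(2) by (simp add: ip_comm[of r] ip_comm[of q])
  qed
  \<comment> \<open>Read off from \<open>p + s * r\<close> with
    \<open>r = \<phi> k - q\<close>.\<close>
  define c' where "c' j = (if j = k then s else d j - s * c j)" for j
  have "(\<Sum>j\<in>insert k I. c' j * \<phi> j x) = new x" for x
  proof -
    have "(\<Sum>j\<in>I. c' j * \<phi> j x) = (\<Sum>j\<in>I. (d j - s * c j) * \<phi> j x)"
      using insert.hyps by (intro sum.cong) (auto simp: c'_def)
    also have "\<dots> = p x - s * q x"
      by (simp add: p_def q_def left_diff_distrib sum_subtractf sum_distrib_left mult.assoc)
    finally show ?thesis
      using insert.hyps by (simp add: c'_def[of k] new_def r_def algebra_simps)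
  qed
  then show ?case
    using new_I new_k unfolding ip_def by (intro exI[of _ c']) auto
qed

text \<open>Existence applies the span lemma to the monomials. The difference of two candidates is a
  polynomial orthogonal to itself, hence zero almost everywhere on \<open>D\<close>. By continuity
  its nonzero set in the interior is an open null set, hence empty, and a polynomial vanishing on a
  nonempty open set vanishes everywhere.\<close>

lemma L2_proj_spec:
  fixes D :: "(real ^ 'd) set"
  assumes D: "compact D" "interior D \<noteq> {}" and g: "continuous_on D g"
  shows "L2_proj D N g \<in> poly_space N"
    and "\<And>q. q \<in> poly_space N \<Longrightarrow>
      (LINT x:D|lborel. L2_proj D N g x * q x) = (LINT x:D|lborel. g x * q x)"
proof -
  let ?P = "\<lambda>p. p \<in> poly_space N \<and>
        (\<forall>q\<in>poly_space N. (LINT x:D|lborel. p x * q x) = (LINT x:D|lborel. g x * q x))"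
  let ?I = "{\<alpha> :: 'd \<Rightarrow> nat. sum \<alpha> UNIV \<le> N}"
  define mon where "mon \<alpha> x = (\<Prod>i\<in>UNIV. (x $ i) ^ \<alpha> i)" for \<alpha> :: "'d \<Rightarrow> nat" and x :: "real ^ 'd"
  have cm: "continuous_on D (mon \<alpha>)" for \<alpha>
    unfolding mon_def by (intro continuous_intros)
  have int: "set_integrable lborel D (\<lambda>x. f x * h x)"
    if "continuous_on D f" "continuous_on D h" for f h :: "real ^ 'd \<Rightarrow> real"
    using that by (intro set_integrable_continuous_compact D continuous_on_mult)
  have ex: "\<exists>p. ?P p"
  proof -
    obtain c where c: "\<forall>i\<in>?I. (LINT x:D|lborel. (\<Sum>j\<in>?I. c j * mon j x) * mon i x) = (LINT x:D|lborel. g x * mon i x)"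
      using ex_L2_projection_span[where \<phi> = mon, OF D(1) finite_multi_indices cm g] by blast
    define p where "p = (\<lambda>x. \<Sum>j\<in>?I. c j * mon j x)"
    have cp: "continuous_on D p" unfolding p_def by (intro continuous_intros cm)
    have lin: "(LINT x:D|lborel. f x * (\<Sum>j\<in>?I. b j * mon j x))
        = (\<Sum>j\<in>?I. b j * (LINT x:D|lborel. f x * mon j x))" if f: "continuous_on D f" for f b
    proof -
      have "integrable lborel (\<lambda>x. indicator D x *\<^sub>R (b j * (f x * mon j x)))" for j
        by (intro borel_integrable_compact D continuous_intros f cm)
      then have "(LINT x:D|lborel. \<Sum>j\<in>?I. b j * (f x * mon j x))
          = (\<Sum>j\<in>?I. LINT x:D|lborel. b j * (f x * mon j x))"
        unfolding set_lebesgue_integral_def scaleR_sum_right by (rule Bochner_Integration.integral_sum)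
      then show ?thesis by (simp add: sum_distrib_left mult.left_commute)
    qed
    have "p \<in> poly_space N"
      unfolding poly_space_def p_def mon_def by blast
    moreover have "(LINT x:D|lborel. p x * q x) = (LINT x:D|lborel. g x * q x)" if q: "q \<in> poly_space N" for q
    proof -
      obtain b where "q = (\<lambda>x. \<Sum>j\<in>?I. b j * mon j x)"
        using q by (auto simp: poly_space_def mon_def)
      then show ?thesis using lin[OF cp, of b] lin[OF g, of b] c by (simp add: p_def)
    qed
    ultimately show ?thesis by blast
  qed
  have unique: "p = p'" if p: "?P p" "?P p'" for p p'
  proof -
    define r where "r x = p x - p' x" for x
    have r: "r \<in> poly_space N" unfolding r_def using p by (intro poly_space_diff) auto
    have cr: "continuous_on D r" and cp: "continuous_on D p" and cp': "continuous_on D p'"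
      using r p poly_space_continuous by blast+
    have "(LINT x:D|lborel. r x * r x) = (LINT x:D|lborel. p x * r x) - (LINT x:D|lborel. p' x * r x)"
      using set_integral_diff(2)[OF int[OF cp cr] int[OF cp' cr]] by (simp add: r_def left_diff_distrib)
    then have "(LINT x|lborel. indicator D x *\<^sub>R (r x * r x)) = 0"
      using p r by (simp add: set_lebesgue_integral_def)
    then have AE0: "AE x in lborel. indicator D x *\<^sub>R (r x * r x) = 0"
      using int[OF cr cr] by (subst (asm) integral_nonneg_eq_0_iff_AE) (auto simp: set_integrable_def)
    define V where "V = {x \<in> interior D. r x \<noteq> 0}"
    have "open V"
    proof -
      have "open ({x. r x \<noteq> 0} \<inter> interior D)"
        using open_Collect_neq[of r "\<lambda>_. 0"] poly_space_continuous[OF r, of UNIV] by (intro open_Int) auto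
      then show ?thesis by (simp add: V_def Int_def conj_commute)
    qed
    moreover have "AE x in lborel. x \<notin> V"
      using AE0 by eventually_elim (use interior_subset[of D] in \<open>auto simp: V_def\<close>)
    then have "V \<in> null_sets lborel"
      using \<open>open V\<close> by (subst (asm) AE_iff_null_sets[symmetric]) auto
    then have "negligible V"
      using null_sets_completionI by (auto simp: negligible_iff_null_sets)
    ultimately have "V = {}" using open_not_negligible by blast
    then have "r x = 0" for x
      using poly_space_eq_0[OF r open_interior D(2)] by (auto simp: V_def)
    then show ?thesis by (auto simp: r_def)
  qed
  have spec: "?P (L2_proj D N g)"
    unfolding L2_proj_def by (rule theI'[OF ex_ex1I[OF ex unique]])
  show "L2_proj D N g \<in> poly_space N"
    by (rule conjunct1[OF spec])
  show "(LINT x:D|lborel. L2_proj D N g x * q x) = (LINT x:D|lborel. g x * q x)"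
    if "q \<in> poly_space N" for q
    by (rule bspec[OF conjunct2[OF spec] that])
qed

lemma vec_poly_space_C1:
  fixes p :: "real ^ 'd \<Rightarrow> real ^ 'n"
  assumes "p \<in> vec_poly_space N"
  shows "\<exists>P. \<forall>x. (p has_derivative P x) (at x) \<and> (\<forall>e. continuous_on UNIV (\<lambda>x. P x e))"
proof -
  have "\<forall>i. \<exists>P. \<forall>x. ((\<lambda>x. p x $ i) has_derivative P x) (at x) \<and> (\<forall>e. continuous_on UNIV (\<lambda>x. P x e))"
    using assms poly_space_C1 unfolding vec_poly_space_def by blast
  then obtain P where P: "\<And>i x. ((\<lambda>x. p x $ i) has_derivative P i x) (at x)"
    "\<And>i e. continuous_on UNIV (\<lambda>x. P i x e)" by metis
  have "(p has_derivative (\<lambda>h. \<chi> i. P i x h)) (at x)" for x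
    by (subst has_derivative_componentwise_within)
       (auto simp: Basis_vec_def inner_axis P)
  moreover have "continuous_on UNIV (\<lambda>x. \<chi> i. P i x e)" for e
    by (intro continuous_on_vec_lambda P)
  ultimately show ?thesis by (intro exI[of _ "\<lambda>x h. \<chi> i. P i x h"]) blast
qed

lemma vec_L2_proj_poly:
  fixes g :: "real ^ 'd \<Rightarrow> real ^ 'n"
  assumes "compact D" "interior D \<noteq> {}" "continuous_on D g"
  shows "vec_L2_proj D N g \<in> vec_poly_space N"
  unfolding vec_poly_space_def vec_L2_proj_def
  by (auto intro!: L2_proj_spec(1)[OF assms(1,2)] continuous_on_component assms(3))

lemma vec_poly_space_continuous: "p \<in> vec_poly_space N \<Longrightarrow> continuous_on D p"
  using vec_poly_space_C1 has_derivative_continuous_on has_derivative_at_withinI by meson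

lemma vec_L2_proj_residual_orthogonal:
  fixes g p :: "real ^ 'd \<Rightarrow> real ^ 'n"
  assumes D: "compact D" "interior D \<noteq> {}" and g: "continuous_on D g" and p: "p \<in> vec_poly_space N"
  shows "(LINT x:D|lborel. p x \<bullet> (vec_L2_proj D N g x - g x)) = 0"
proof -
  have cg: "continuous_on D (\<lambda>x. g x $ i)" for i using g by (intro continuous_intros)
  have cp: "continuous_on D (\<lambda>x. p x $ i)" for i
    using vec_poly_space_continuous[OF p] by (intro continuous_intros)
  have cw: "continuous_on D (L2_proj D N (\<lambda>x. g x $ i))" for i
    by (rule poly_space_continuous[OF L2_proj_spec(1)[OF D cg]])
  have int: "set_integrable lborel D (\<lambda>x. f x * h x)"
    if "continuous_on D f" "continuous_on D h" for f h :: "real ^ 'd \<Rightarrow> real"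
    using that by (intro set_integrable_continuous_compact D continuous_on_mult)
  have comp: "(LINT x:D|lborel. p x $ i * (L2_proj D N (\<lambda>x. g x $ i) x - g x $ i)) = 0" for i
  proof -
    have "(\<lambda>x. p x $ i) \<in> poly_space N" using p by (simp add: vec_poly_space_def)
    from L2_proj_spec(2)[OF D cg this, of i] set_integral_diff(2)[OF int[OF cw[of i] cp[of i]] int[OF cg[of i] cp[of i]]]
    show ?thesis by (simp add: algebra_simps)
  qed
  have "integrable lborel (\<lambda>x. indicator D x *\<^sub>R (p x $ i * (L2_proj D N (\<lambda>x. g x $ i) x - g x $ i)))" for i
    by (intro borel_integrable_compact D continuous_intros cp cw cg)
  then have "(LINT x:D|lborel. \<Sum>i\<in>UNIV. p x $ i * (L2_proj D N (\<lambda>x. g x $ i) x - g x $ i))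
      = (\<Sum>i\<in>UNIV. LINT x:D|lborel. p x $ i * (L2_proj D N (\<lambda>x. g x $ i) x - g x $ i))"
    unfolding set_lebesgue_integral_def scaleR_sum_right by (rule Bochner_Integration.integral_sum)
  then show ?thesis
    by (simp add: inner_vec_def vec_L2_proj_def comp)
qed

section \<open>Gradients of convex functions\<close>

text \<open>By convexity the difference quotients along the segment from \<open>x\<close> to
  \<open>y\<close> are at most \<open>S y - S x\<close>; their limit from the right at 0 is the
  directional derivative.\<close>

lemma convex_gradient_lower_bound:
  fixes S :: "'a::real_inner \<Rightarrow> real"
  assumes S: "convex_on U S" and x: "x \<in> U" and y: "y \<in> U" and v: "GDERIV S x :> v"
  shows "S x + v \<bullet> (y - x) \<le> S y"
proof -
  let ?l = "\<lambda>t. x + t *\<^sub>R (y - x)"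
  have "(S has_derivative (\<lambda>h. h \<bullet> v)) (at (?l 0))"
    using v by (simp add: gderiv_def)
  moreover have "(?l has_derivative (\<lambda>h. h *\<^sub>R (y - x))) (at 0)"
    by (auto intro!: derivative_eq_intros)
  ultimately have "((\<lambda>t. S (?l t)) has_derivative (\<lambda>h. (h *\<^sub>R (y - x)) \<bullet> v)) (at 0)"
    using has_derivative_compose by blast
  moreover have "(\<lambda>h. (h *\<^sub>R (y - x)) \<bullet> v) = (*) (v \<bullet> (y - x))"
    by (auto simp: inner_commute mult.commute)
  ultimately have "((\<lambda>t. S (?l t)) has_real_derivative (v \<bullet> (y - x))) (at 0)"
    by (simp add: has_field_derivative_def)
  then have "((\<lambda>t. (S (?l t) - S x) / t) \<longlongrightarrow> v \<bullet> (y - x)) (at 0)"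
    by (simp add: DERIV_def)
  then have lim: "((\<lambda>t. (S (?l t) - S x) / t) \<longlongrightarrow> v \<bullet> (y - x)) (at_right 0)"
    by (rule filterlim_mono) (auto simp: at_le)
  have "eventually (\<lambda>t. (S (?l t) - S x) / t \<le> S y - S x) (at_right (0::real))"
    unfolding eventually_at_right_field
  proof (intro exI[of _ 1] conjI allI impI)
    fix t :: real assume t: "0 < t" "t < 1"
    have "?l t = (1 - t) *\<^sub>R x + t *\<^sub>R y" by (simp add: algebra_simps)
    then have "S (?l t) \<le> (1 - t) * S x + t * S y"
      using convex_onD[OF S, of t x y] x y t by simp
    then show "(S (?l t) - S x) / t \<le> S y - S x"
      using t by (simp add: field_simps)
  qed simp
  then have "v \<bullet> (y - x) \<le> S y - S x"
    using lim by (intro tendsto_upperbound) auto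
  then show ?thesis by simp
qed

text \<open>It makes the entropy variables of a polynomial state continuous, so that their
  projection exists and the integrals can be split.\<close>

lemma convex_gradient_continuous:
  fixes S :: "'a::real_inner \<Rightarrow> real"
  assumes U: "open U" and S: "convex_on U S" and v: "\<And>u. u \<in> U \<Longrightarrow> GDERIV S u :> v u"
  shows "continuous_on U v"
  unfolding continuous_on_iff
proof (intro ballI allI impI)
  fix x and \<epsilon> :: real assume x: "x \<in> U" and \<epsilon>: "\<epsilon> > 0"
  \<comment> \<open>The comparison ends with a bound of \<open>2 * \<eta>\<close>, that is half of
    \<open>\<epsilon>\<close>.\<close>
  define \<eta> where "\<eta> = \<epsilon> / 4"
  have \<eta>: "\<eta> > 0" using \<epsilon> by (simp add: \<eta>_def)
  have "(S has_derivative (\<lambda>h. h \<bullet> v x)) (at x)"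
    using v[OF x] by (simp add: gderiv_def)
  then obtain d where d: "d > 0"
    "\<And>y. norm (y - x) < d \<Longrightarrow> norm (S y - S x - (y - x) \<bullet> v x) \<le> \<eta> * norm (y - x)"
    using \<eta> by (auto simp: has_derivative_within_alt)
  obtain r where r: "r > 0" "ball x r \<subseteq> U" using U x open_contains_ball by blast
  \<comment> \<open>The point \<open>y + h\<close> is within \<open>2 * \<delta>\<close> of
    \<open>x\<close>; a third of the minimum keeps it in \<open>U\<close> and in the range of the
    derivative estimate.\<close>
  define \<delta> where "\<delta> = min d r / 3"
  have \<delta>: "\<delta> > 0" "2 * \<delta> < d" "2 * \<delta> < r" using d r by (auto simp: \<delta>_def)
  text \<open>
    Differentiability at \<open>x\<close> bounds \<open>S\<close> above near \<open>x\<close> and the tangent planes at \<open>x\<close> and \<open>y\<close>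
    bound it below; the bounds are compared at \<open>y + h\<close> with \<open>h\<close> in the direction of \<open>v y - v x\<close>.
  \<close>
  have "dist (v y) (v x) < \<epsilon>" if y: "y \<in> U" "dist y x < \<delta>" for y
  proof (cases "v y = v x")
    case False
    define n where "n = norm (v y - v x)"
    have n: "n > 0" using False by (simp add: n_def)
    define h where "h = (\<delta> / n) *\<^sub>R (v y - v x)"
    have nh: "norm h = \<delta>" using n \<delta> by (simp add: h_def n_def)
    have yx: "norm (y - x) < \<delta>" using y by (simp add: dist_norm)
    have yh: "norm (y + h - x) \<le> 2 * \<delta>"
      using norm_triangle_ineq[of "y - x" h] nh yx by (simp add: algebra_simps)
    then have "y + h \<in> U" using r \<delta> by (auto simp: dist_norm norm_minus_commute)
    then have "S y + v y \<bullet> h \<le> S (y + h)"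
      using convex_gradient_lower_bound[OF S y(1) _ v[OF y(1)], of "y + h"] by simp
    moreover have "S x + v x \<bullet> (y - x) \<le> S y"
      by (rule convex_gradient_lower_bound[OF S x y(1) v[OF x]])
    moreover have "S (y + h) - S x - (y + h - x) \<bullet> v x \<le> \<eta> * (2 * \<delta>)"
    proof -
      have "\<bar>S (y + h) - S x - (y + h - x) \<bullet> v x\<bar> \<le> \<eta> * norm (y + h - x)"
        using d(2)[of "y + h"] yh \<delta> by simp
      also have "\<dots> \<le> \<eta> * (2 * \<delta>)" by (rule mult_left_mono[OF yh]) (use \<eta> in simp)
      finally show ?thesis by simp
    qed
    moreover have "(y + h - x) \<bullet> v x = v x \<bullet> (y - x) + v x \<bullet> h"
      by (simp add: inner_commute algebra_simps)
    ultimately have "(v y - v x) \<bullet> h \<le> \<eta> * (2 * \<delta>)"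
      by (simp add: inner_diff_left)
    moreover have "(v y - v x) \<bullet> h = n * \<delta>"
      using n by (simp add: h_def n_def dot_square_norm power2_eq_square)
    ultimately have "n \<le> 2 * \<eta>" using \<delta> by simp
    then show ?thesis using \<epsilon> by (simp add: n_def dist_norm \<eta>_def)
  qed (use \<epsilon> in simp)
  then show "\<exists>\<delta>>0. \<forall>y\<in>U. dist y x < \<delta> \<longrightarrow> dist (v y) (v x) < \<epsilon>"
    using \<delta>(1) by blast
qed

section \<open>The volume entropy residual\<close>

text \<open>On \<open>D\<close> the potential is \<open>w \<bullet> f u - F u\<close>, where
  \<open>v\<close> enters only through \<open>w\<close>, whose derivative is given. In the product
  rule the term with \<open>f'\<close> equals the derivative of \<open>F\<close> along
  \<open>u\<close> and cancels.\<close>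

lemma entropy_potential_has_derivative:
  fixes v f :: "real ^ 'n \<Rightarrow> real ^ 'n" and u w :: "'a::real_normed_vector \<Rightarrow> real ^ 'n"
  assumes F: "entropy_flux_on U v f F" "\<And>u. u \<in> U \<Longrightarrow> F u = v u \<bullet> f u - \<psi> u"
    and u: "\<And>x. x \<in> D \<Longrightarrow> u x \<in> U" "\<And>x. x \<in> D \<Longrightarrow> v (u x) = w x"
    and x: "x \<in> D" and du: "u differentiable (at x within D)" and dw: "(w has_derivative W) (at x)"
  shows "((\<lambda>y. \<psi> (u y)) has_derivative (\<lambda>h. W h \<bullet> f (u x))) (at x within D)"
proof -
  obtain u' where u': "(u has_derivative u') (at x within D)"
    using du by (auto simp: differentiable_def)
  obtain f' where f': "(f has_derivative f') (at (u x))"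
    and F': "(F has_derivative (\<lambda>h. v (u x) \<bullet> f' h)) (at (u x))"
    using F(1) u(1)[OF x] unfolding entropy_flux_on_def by blast
  have "((\<lambda>y. w y \<bullet> f (u y) - F (u y)) has_derivative
      (\<lambda>h. (w x \<bullet> f' (u' h) + W h \<bullet> f (u x)) - v (u x) \<bullet> f' (u' h))) (at x within D)"
    by (intro has_derivative_diff has_derivative_inner has_derivative_at_withinI[OF dw]
        has_derivative_compose[OF u' f'] has_derivative_compose[OF u' F'])
  moreover have "(\<lambda>h. (w x \<bullet> f' (u' h) + W h \<bullet> f (u x)) - v (u x) \<bullet> f' (u' h)) = (\<lambda>h. W h \<bullet> f (u x))"
    using u(2)[OF x] by auto
  ultimately have "((\<lambda>y. w y \<bullet> f (u y) - F (u y)) has_derivative (\<lambda>h. W h \<bullet> f (u x))) (at x within D)"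
    by simp
  then show ?thesis
    by (rule has_derivative_transform[OF x, rotated]) (use F(2) u in auto)
qed

lemma continuous_on_matrix_vector_mult:
  fixes A :: "'a::topological_space \<Rightarrow> real ^ 'n ^ 'm"
  assumes "continuous_on D A" "continuous_on D z"
  shows "continuous_on D (\<lambda>x. A x *v z x)"
  unfolding matrix_vector_mult_def
  by (intro continuous_on_vec_lambda continuous_intros continuous_on_component assms)

lemma inner_symmetric_matrix:
  fixes A :: "real ^ 'n ^ 'n"
  assumes "transpose A = A"
  shows "x \<bullet> (A *v y) = (A *v x) \<bullet> y"
  using assms by (metis dot_lmul_matrix transpose_matrix_vector)

theorem lemma4:
  fixes U :: "(real ^ 'n) set"
    and S :: "real ^ 'n \<Rightarrow> real"
    and v :: "real ^ 'n \<Rightarrow> real ^ 'n"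
    and f :: "'d::finite \<Rightarrow> real ^ 'n \<Rightarrow> real ^ 'n"
    and F \<psi> :: "'d \<Rightarrow> real ^ 'n \<Rightarrow> real"
    and A :: "'d \<Rightarrow> real ^ 'n \<Rightarrow> real ^ 'n \<Rightarrow> real ^ 'n ^ 'n"
    and D :: "(real ^ 'd) set"
    and N :: nat
    and u\<^sub>h w u_tilde :: "real ^ 'd \<Rightarrow> real ^ 'n"
  assumes "open U"
    and "entropy_variables_on U S v"
    and "\<And>m. entropy_flux_on U v (f m) (F m)"
    and "\<And>m u. u \<in> U \<Longrightarrow> F m u = v u \<bullet> f m u - \<psi> m u"
    and "int CARD('d) simplex D"
    and "u\<^sub>h \<in> vec_poly_space N"
    and "u\<^sub>h ` D \<subseteq> U"
    and w: "w = proj_entropy_variables D N v u\<^sub>h"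
    and "w ` D \<subseteq> v ` U"
    and u_tilde: "u_tilde = entropy_projection U D N v u\<^sub>h"
    and "u_tilde differentiable_on D"
    and "\<And>m. (\<lambda>x. f m (u\<^sub>h x)) differentiable_on D"
    and "\<And>m. (\<lambda>x. f m (u_tilde x)) differentiable_on D"
    and "\<And>m. roe_linearization_on U v (f m) (A m)"
    and "\<And>m. continuous_on (U \<times> U) (\<lambda>(u1, u2). A m u1 u2)"
  shows "volume_entropy_residual U D N v f \<psi> u\<^sub>h =
    (\<Sum>m\<in>UNIV. LINT x:D|lborel.
       (A m (u_tilde x) (u\<^sub>h x) *v partial_deriv m w x
        - vec_L2_proj D N (\<lambda>y. A m (u_tilde y) (u\<^sub>h y) *v partial_deriv m w y) x)
       \<bullet> (w x - v (u\<^sub>h x)))"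
proof -
  have D: "compact D" "interior D \<noteq> {}"
    using assms(5) interior_simplex simplex_imp_polytope polytope_imp_compact by blast+
  have "continuous_on U v"
    using assms(1,2) unfolding entropy_variables_on_def
    by (intro convex_gradient_continuous[of U S]) auto
  moreover have cont_uh: "continuous_on D u\<^sub>h" by (rule vec_poly_space_continuous[OF assms(6)])
  ultimately have cont_vuh: "continuous_on D (\<lambda>x. v (u\<^sub>h x))"
    using assms(7) continuous_on_compose2 by blast
  have w_proj: "w = vec_L2_proj D N (\<lambda>x. v (u\<^sub>h x))"
    by (simp add: w proj_entropy_variables_def)
  then have w_poly: "w \<in> vec_poly_space N"
    using vec_L2_proj_poly[OF D cont_vuh] by simp
  obtain W where W: "\<And>x. (w has_derivative W x) (at x)" "\<And>e. continuous_on UNIV (\<lambda>x. W x e)"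
    using vec_poly_space_C1[OF w_poly] by blast
  have partial: "partial_deriv m w x = W x (axis m 1)" for m x
    using frechet_derivative_at[OF W(1)] by (simp add: partial_deriv_def)
  have u_tilde_inv: "u_tilde x = inv_into U v (w x)" for x
    by (simp add: u_tilde entropy_projection_def w)
  have ut: "u_tilde x \<in> U" "v (u_tilde x) = w x" if "x \<in> D" for x
    using that assms(9) unfolding u_tilde_inv by (auto intro!: inv_into_into f_inv_into_f)
  have uh: "u\<^sub>h x \<in> U" if "x \<in> D" for x using that assms(7) by blast
  have cont_ut: "continuous_on D u_tilde"
    using assms(11) by (rule differentiable_imp_continuous_on)
  have cont_w: "continuous_on D w" by (rule vec_poly_space_continuous[OF w_poly])
  have cont_W: "continuous_on D (\<lambda>x. W x e)" for e
    using W(2) continuous_on_subset by blast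
  have residual: "(LINT x:D|lborel. - (partial_deriv m w x \<bullet> f m (u\<^sub>h x)))
      + boundary_integral D (\<lambda>x \<nu>. \<psi> m (u_tilde x) * \<nu> $ m)
    = (LINT x:D|lborel. (A m (u_tilde x) (u\<^sub>h x) *v partial_deriv m w x
        - vec_L2_proj D N (\<lambda>y. A m (u_tilde y) (u\<^sub>h y) *v partial_deriv m w y) x)
       \<bullet> (w x - v (u\<^sub>h x)))" for m
  proof -
    let ?e = "axis m 1 :: real ^ 'd"
    define z where "z x = A m (u_tilde x) (u\<^sub>h x) *v W x ?e" for x
    have cont_fut: "continuous_on D (\<lambda>x. f m (u_tilde x))"
      and cont_fuh: "continuous_on D (\<lambda>x. f m (u\<^sub>h x))"
      using assms(12,13) by (auto intro: differentiable_imp_continuous_on)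
    have boundary: "boundary_integral D (\<lambda>x \<nu>. \<psi> m (u_tilde x) * \<nu> $ m)
        = (LINT x:D|lborel. W x ?e \<bullet> f m (u_tilde x))"
    proof (rule divergence_simplex[OF assms(5)])
      show "((\<lambda>y. \<psi> m (u_tilde y)) has_derivative (\<lambda>h. W x h \<bullet> f m (u_tilde x))) (at x within D)"
        if "x \<in> D" for x
        using assms(11) that
        by (intro entropy_potential_has_derivative[OF assms(3,4) ut that _ W(1)])
           (auto simp: differentiable_on_def)
      show "continuous_on D (\<lambda>x. W x e \<bullet> f m (u_tilde x))" for e
        by (intro continuous_intros cont_W cont_fut)
    qed
    have "continuous_on D (\<lambda>x. (\<lambda>(u1, u2). A m u1 u2) (u_tilde x, u\<^sub>h x))"
      by (rule continuous_on_compose2[OF assms(15)])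
         (use ut uh in \<open>auto intro!: continuous_intros cont_ut cont_uh\<close>)
    \<comment> \<open>This makes the definite description for the projection of \<open>z\<close>
      well-defined, so that the projection is a polynomial and orthogonality applies to it.\<close>
    then have cont_z: "continuous_on D z"
      unfolding z_def by (intro continuous_on_matrix_vector_mult cont_W) simp
    have cont_pz: "continuous_on D (vec_L2_proj D N z)"
      by (rule vec_poly_space_continuous[OF vec_L2_proj_poly[OF D cont_z]])
    have roe: "W x ?e \<bullet> f m (u_tilde x) - W x ?e \<bullet> f m (u\<^sub>h x) = z x \<bullet> (w x - v (u\<^sub>h x))"
      if x: "x \<in> D" for x
    proof -
      have "f m (u_tilde x) - f m (u\<^sub>h x) = A m (u_tilde x) (u\<^sub>h x) *v (w x - v (u\<^sub>h x))"
        and sym: "transpose (A m (u_tilde x) (u\<^sub>h x)) = A m (u_tilde x) (u\<^sub>h x)"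
        using assms(14)[of m] ut[OF x] uh[OF x] unfolding roe_linearization_on_def by metis+
      then show ?thesis
        by (simp add: z_def inner_diff_right[symmetric] inner_symmetric_matrix[OF sym])
    qed
    have "(LINT x:D|lborel. - (W x ?e \<bullet> f m (u\<^sub>h x))) + (LINT x:D|lborel. W x ?e \<bullet> f m (u_tilde x))
        = (LINT x:D|lborel. - (W x ?e \<bullet> f m (u\<^sub>h x)) + W x ?e \<bullet> f m (u_tilde x))"
      by (intro set_integral_add(2)[symmetric] set_integrable_continuous_compact D(1)
          continuous_intros cont_W cont_fuh cont_fut)
    also have "\<dots> = (LINT x:D|lborel. z x \<bullet> (w x - v (u\<^sub>h x)))"
      using roe D(1) by (intro set_lebesgue_integral_cong) (auto simp: borel_compact)
    also have "\<dots> = (LINT x:D|lborel. z x \<bullet> (w x - v (u\<^sub>h x)))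
        - (LINT x:D|lborel. vec_L2_proj D N z x \<bullet> (w x - v (u\<^sub>h x)))"
      using vec_L2_proj_residual_orthogonal[OF D cont_vuh vec_L2_proj_poly[OF D cont_z]]
      by (simp add: w_proj)
    also have "\<dots> = (LINT x:D|lborel. z x \<bullet> (w x - v (u\<^sub>h x)) - vec_L2_proj D N z x \<bullet> (w x - v (u\<^sub>h x)))"
      by (intro set_integral_diff(2)[symmetric] set_integrable_continuous_compact D(1)
          continuous_intros cont_z cont_pz cont_w cont_vuh)
    finally show ?thesis
      unfolding partial boundary z_def[abs_def] by (simp add: inner_diff_left)
  qed
  show ?thesis
    unfolding volume_entropy_residual_def w[symmetric] u_tilde[symmetric]
    by (rule sum.cong[OF refl residual])
qed

end
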